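(* Let $n\ge 1$ and let $[0,1]^n$ be equipped with the $l^1$-distance $d_{l^1}(x,y)=\sum_{i=1}^n|x_i-y_i|$ and the uniform measure $m_{[0,1]^n}=\mathcal{L}^n|_{[0,1]^n}$ ($n$-dimensional Lebesgue measure). Let $d_0:[0,1]^n\to\mathbb{R}$, $d_0(x)=d_{l^1}(x,0)$, be the distance function from the origin. Then $(d_0)_*m_{[0,1]^n}$ is the maximum of $\mathcal{M}([0,1]^n;1)$ with respect to the iso-Lipschitz order $\succ'$; that is, $(d_0)_*m_{[0,1]^n}\in\mathcal{M}([0,1]^n;1)$ and $(d_0)_*m_{[0,1]^n}\succ'\mu$ for every $\mu\in\mathcal{M}([0,1]^n;1)$.
   Context: For a complete separable metric space $(X,d_X)$ with a Borel probability measure $m_X$, the 1-measurement is $\mathcal{M}(X;1):=\{\varphi_*m_X\mid \varphi:X\to\mathbb{R}\ \text{1-Lipschitz}\}$, where $\varphi_*m_X$ is the push-forward and 1-Lipschitz means Lipschitz constant at most $1$. For Borel probability measures $\mu,\nu$ on $\mathbb{R}$, $\mu\succ'\nu$ (iso-Lipschitz order) means that there exists a monotone non-decreasing 1-Lipschitz function $f:\operatorname{supp}\mu\to\operatorname{supp}\nu$ with $f_*\mu=\nu$. *)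

theory Defs
  imports "HOL-Analysis.Analysis"
begin

definition l1_dist :: "real ^ 'n \<Rightarrow> real ^ 'n \<Rightarrow> real" where
  "l1_dist x y = (\<Sum>i\<in>UNIV. \<bar>x $ i - y $ i\<bar>)"

definition unit_cube :: "(real ^ 'n) set" where
  "unit_cube = {x. \<forall>i. 0 \<le> x $ i \<and> x $ i \<le> 1}"

definition l1_cube :: "(real ^ 'n) metric" where
  "l1_cube = metric (unit_cube, l1_dist)"

definition cube_measure :: "(real ^ 'n) measure" where
  "cube_measure = restrict_space lborel unit_cube"

(* M is a Borel measure on the space X. The Lipschitz condition only involves points of X, so the
   values of phi elsewhere are irrelevant, as distr only sees phi on space M = mspace X. *)
definition one_measurement :: "'a metric \<Rightarrow> 'a measure \<Rightarrow> real measure set" where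
  "one_measurement X M =
     {distr M borel \<phi> | \<phi>. \<forall>x\<in>mspace X. \<forall>y\<in>mspace X. \<bar>\<phi> x - \<phi> y\<bar> \<le> mdist X x y}"

definition msupport :: "'a::topological_space measure \<Rightarrow> 'a set" where
  "msupport \<mu> = {x. \<forall>U. open U \<longrightarrow> x \<in> U \<longrightarrow> emeasure \<mu> U > 0}"

(* f is only defined on the support of mu, hence the restriction before pushing forward;
   a Borel probability measure on the reals is concentrated on its support. *)
definition iso_Lipschitz_ge :: "real measure \<Rightarrow> real measure \<Rightarrow> bool"  (infix "\<succ>''" 50) where
  "\<mu> \<succ>' \<nu> \<longleftrightarrow>
     (\<exists>f. f \<in> msupport \<mu> \<rightarrow> msupport \<nu> \<and> mono_on (msupport \<mu>) f \<and>
          1-lipschitz_on (msupport \<mu>) f \<and>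
          distr (restrict_space \<mu> (msupport \<mu>)) borel f = \<nu>)"

lemma Metric_space_l1: "Metric_space unit_cube (l1_dist :: real ^ 'n \<Rightarrow> real ^ 'n \<Rightarrow> real)"
proof
  fix x y z :: "real ^ 'n"
  show "0 \<le> l1_dist x y" by (simp add: l1_dist_def sum_nonneg)
  show "l1_dist x y = l1_dist y x" by (simp add: l1_dist_def abs_minus_commute)
  show "(l1_dist x y = 0) = (x = y)"
    by (simp add: l1_dist_def sum_nonneg_eq_0_iff vec_eq_iff)
  show "l1_dist x z \<le> l1_dist x y + l1_dist y z"
    unfolding l1_dist_def sum.distrib[symmetric] by (intro sum_mono) simp
qed

lemma mspace_l1_cube [simp]: "mspace l1_cube = unit_cube"
  and mdist_l1_cube [simp]: "mdist l1_cube = l1_dist"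
  by (simp_all add: l1_cube_def Metric_space_l1 Metric_space.mspace_metric Metric_space.mdist_metric)

lemma norm_le_l1_dist: "dist x y \<le> l1_dist x y"
  unfolding dist_norm l1_dist_def using norm_le_l1_cart[of "x - y"] by simp

lemma l1_dist_le_norm: "l1_dist x y \<le> CARD('n) * dist x y" for x y :: "real ^ 'n"
  unfolding l1_dist_def dist_norm
  using sum_bounded_above[of UNIV "\<lambda>i. \<bar>x $ i - y $ i\<bar>" "norm (x - y)"]
    component_le_norm_cart[of "x - y"] by simp

lemma mtopology_l1_cube: "mtopology_of (l1_cube :: (real ^ 'n) metric) = top_of_set unit_cube"
proof -
  interpret L: Metric_space unit_cube "l1_dist :: real ^ 'n \<Rightarrow> _" by (rule Metric_space_l1)
  interpret E: Metric_space unit_cube "dist :: real ^ 'n \<Rightarrow> _"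
    by unfold_locales (auto simp: dist_commute dist_triangle)
  have "openin L.mtopology U \<longleftrightarrow> openin E.mtopology U" for U
  proof -
    have *: "E.mball x (r / CARD('n)) \<subseteq> L.mball x r" for x r
    proof
      fix y assume "y \<in> E.mball x (r / CARD('n))"
      then show "y \<in> L.mball x r"
        using l1_dist_le_norm[of x y] by (simp add: field_simps)
    qed
    have **: "L.mball x r \<subseteq> E.mball x r" for x r
      by (auto intro: le_less_trans[OF norm_le_l1_dist])
    show ?thesis
      unfolding L.openin_mtopology E.openin_mtopology
      using * ** by (meson divide_pos_pos of_nat_0_less_iff zero_less_card_finite subset_trans)
  qed
  then have "L.mtopology = E.mtopology" by (simp add: topology_eq)
  also have "E.mtopology = top_of_set unit_cube"
    using Submetric.mtopology_submetric[of UNIV dist "unit_cube :: (real ^ 'n) set"]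
    by (simp add: Submetric_def Submetric_axioms_def Met_TC.Metric_space_axioms mtopology_is_euclidean)
  finally show ?thesis by (simp add: mtopology_of_def)
qed

lemma unit_cube_eq_cbox: "unit_cube = cbox 0 (\<chi> i. 1)"
  by (auto simp: unit_cube_def mem_box_cart)

(* cube_measure is a Borel probability measure on the l1 metric space l1_cube. *)
lemma space_cube_measure: "space cube_measure = mspace l1_cube"
  by (simp add: cube_measure_def space_restrict_space)

lemma sets_cube_measure:
  "sets (cube_measure :: (real ^ 'n) measure) = sigma_sets unit_cube {U. openin (mtopology_of l1_cube) U}"
proof -
  have "{U. openin (top_of_set unit_cube) U} = (\<inter>) (unit_cube :: (real ^ 'n) set) ` {S. open S}"
    by (auto simp: openin_open)
  moreover have "unit_cube \<in> sigma_sets UNIV {S :: (real ^ 'n) set. open S}"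
    using borel_closed[of "unit_cube :: (real ^ 'n) set"]
    by (simp add: borel_def unit_cube_eq_cbox closed_cbox)
  ultimately show ?thesis
    using restricted_sigma[of unit_cube UNIV "{S :: (real ^ 'n) set. open S}"]
    by (simp add: cube_measure_def mtopology_l1_cube borel_def sets_restrict_space sets_measure_of_conv)
qed

lemma emeasure_cube_measure: "emeasure cube_measure (space cube_measure) = 1"
  by (simp add: cube_measure_def unit_cube_eq_cbox emeasure_restrict_space space_restrict_space
      emeasure_lborel_cbox_eq prod.neutral Basis_vec_def inner_axis axis_eq_axis)

end

theory Submission
  imports Defs "HOL-Probability.Probability"
begin

text \<open>Write \<open>G n t\<close> (\<open>simplex_vol\<close>) for the volume of the corner simplex \<open>{x \<in> [0,1]^n. x\<^sub>1 + \<dots> + x\<^sub>n \<le> t}\<close>, which is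
the distribution function of the law of the distance from the origin.  That this law dominates the law of
a 1-Lipschitz \<open>\<phi>\<close> amounts to an isoperimetric inequality (\<open>simplex_isoperimetric_box\<close>):
if \<open>{\<phi> \<le> c}\<close> has at least the volume \<open>G n t\<close> for some \<open>t > 0\<close>, then \<open>{\<phi> \<le> c + H}\<close> has at
least the volume \<open>G n (t + H)\<close>.  Indeed, the monotone rearrangement
\<open>f t = Inf {s. F s > 0 \<and> F s \<ge> G n t}\<close>, with \<open>F\<close> the distribution function of \<open>\<phi>\<close>, always pushes
the first law to the second one, and the inequality says that it is 1-Lipschitz
(\<open>iso_Lipschitz_ge_simplex_law\<close>).

The isoperimetric inequality is proved by induction on the dimension.  In dimension one it says that
enlarging a nonempty subset of \<open>[0,1]\<close> by \<open>h\<close> increases its length by at least \<open>h\<close>, unless it fills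
the interval.  In the step, cut the cube into slices \<open>[0,1]^n \<times> {s}\<close> and let \<open>f k s\<close> be the volume of
the slice of \<open>{\<phi> \<le> c + k h}\<close>, where \<open>h = 1 / N\<close>.  Passing from \<open>k\<close> to \<open>k + 1\<close> does two things:
by the induction hypothesis a slice that has reached \<open>G n (j h)\<close> reaches \<open>G n ((j + 1) h)\<close>, and every
slice absorbs the previous slices at distance at most \<open>h\<close>.  In terms of the lengths \<open>x k j\<close> of
\<open>{s. G n (j h) \<le> f k s}\<close> this reads \<open>x (k + 1) (j + 1) \<ge> x k j\<close> and
\<open>x (k + 1) j \<ge> min 1 (x k j + h)\<close> if \<open>x k j > 0\<close>.  Up to an error \<open>h\<close>, the volume is
\<open>\<Sum>j. a j * x k j\<close> with the increments \<open>a j = G n (j h) - G n ((j - 1) h)\<close>.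

For the simplex, the lengths form the staircase \<open>j \<mapsto> (r - j) h\<close>, truncated to \<open>[0,1]\<close>, and a step
merely replaces \<open>r\<close> by \<open>r + 1\<close>.  The heart of the proof is that a sequence of lengths which is not
behind the staircase in weighted sum is not behind it after the step either
(\<open>staircase_growth\<close>).  This rests on the log-concavity of the weights
(\<open>simplex_vol_increments_log_concave\<close>), which holds since \<open>G (n + 1)\<close> arises from \<open>G n\<close> by averaging
over a sliding window.  Since the comparison is exact on the grid, errors occur only at the beginning
and at the end, and they vanish as \<open>N\<close> tends to infinity.\<close>

section \<open>Volumes of corner simplices\<close>

text \<open>The volume of \<open>{x \<in> [0,1]^n. x\<^sub>1 + \<dots> + x\<^sub>n \<le> t}\<close>, computed by slicing along the last coordinate: the
slice at height \<open>s\<close> is the simplex of size \<open>t - s\<close>.  As a function of \<open>t\<close> it is the Irwin-Hall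
distribution function; dimension \<open>0\<close> gives the unit step at \<open>0\<close>.\<close>

primrec simplex_vol :: "nat \<Rightarrow> real \<Rightarrow> real" where
  "simplex_vol 0 t = (if 0 \<le> t then 1 else 0)"
| "simplex_vol (Suc n) t = integral {t - 1..t} (simplex_vol n)"

lemma simplex_vol_mono: "mono (simplex_vol n)"
proof (induction n)
  case (Suc n)
  have int: "simplex_vol n integrable_on {a..b}" for a b
    using Suc by (intro integrable_on_mono_on) (auto simp: mono_on_def mono_def)
  show ?case
  proof (rule monoI)
    fix x y :: real assume "x \<le> y"
    have "integral {x - 1..x} (simplex_vol n) = integral {y - 1..y} (\<lambda>u. simplex_vol n (u + (x - y)))"
      using integral_shift_real_ivl[of "x - 1" "x - y" x "simplex_vol n"] by (simp add: add.commute)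
    also have "\<dots> \<le> integral {y - 1..y} (simplex_vol n)"
    proof (rule integral_le)
      show "(\<lambda>u. simplex_vol n (u + (x - y))) integrable_on {y - 1..y}"
        using Suc \<open>x \<le> y\<close> by (intro integrable_on_mono_on) (auto simp: mono_on_def mono_def)
    qed (use int \<open>x \<le> y\<close> in \<open>auto intro: monoD[OF Suc]\<close>)
    finally show "simplex_vol (Suc n) x \<le> simplex_vol (Suc n) y" by simp
  qed
qed (auto intro!: monoI)

lemma simplex_vol_integrable: "simplex_vol n integrable_on {a..b}"
  using simplex_vol_mono[of n] by (intro integrable_on_mono_on) (auto simp: mono_on_def mono_def)

lemma simplex_vol_nonneg: "0 \<le> simplex_vol n t"
  by (induction n arbitrary: t) (auto intro!: integral_nonneg simplex_vol_integrable)

lemma simplex_vol_le_1: "simplex_vol n t \<le> 1"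
proof (induction n arbitrary: t)
  case (Suc n)
  have "integral {t - 1..t} (simplex_vol n) \<le> integral {t - 1..t} (\<lambda>_. 1)"
    by (intro integral_le simplex_vol_integrable) (auto intro: Suc)
  then show ?case by simp
qed auto

lemma simplex_vol_neg: "t < 0 \<Longrightarrow> simplex_vol n t = 0"
proof (induction n arbitrary: t)
  case (Suc n)
  have "integral {t - 1..t} (simplex_vol n) = integral {t - 1..t} (\<lambda>_. 0)"
    using Suc by (intro integral_cong) auto
  then show ?case by simp
qed auto

lemma simplex_vol_ge: "real n \<le> t \<Longrightarrow> simplex_vol n t = 1"
proof (induction n arbitrary: t)
  case (Suc n)
  have "integral {t - 1..t} (simplex_vol n) = integral {t - 1..t} (\<lambda>_. 1)"
    using Suc by (intro integral_cong) auto
  then show ?case by simp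
qed auto

text \<open>Moving the window from \<open>x\<close> to \<open>y\<close> adds \<open>[x, y]\<close> and removes \<open>[x - 1, y - 1]\<close>.  With the density
\<open>simplex_vol n u - simplex_vol n (u - 1)\<close> made visible in this way, Lipschitz continuity and strict
monotonicity can be read off without differentiating.\<close>

lemma simplex_vol_diff:
  assumes "x \<le> y"
  shows "simplex_vol (Suc n) y - simplex_vol (Suc n) x
    = integral {x..y} (\<lambda>u. simplex_vol n u - simplex_vol n (u - 1))"
proof -
  let ?G = "simplex_vol n"
  have shift: "integral {x..y} (\<lambda>u. ?G (u - 1)) = integral {x - 1..y - 1} ?G"
    using integral_shift_real_ivl[of "x - 1" "- 1" "y - 1" ?G] by simp
  have "(\<lambda>u. ?G (u - 1)) integrable_on {x..y}"
    using simplex_vol_mono[of n] by (intro integrable_on_mono_on) (auto simp: mono_on_def mono_def)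
  then have "integral {x..y} (\<lambda>u. ?G u - ?G (u - 1)) = integral {x..y} ?G - integral {x - 1..y - 1} ?G"
    by (simp add: integral_diff simplex_vol_integrable shift)
  moreover have "integral {x - 1..y} ?G = integral {x - 1..x} ?G + integral {x..y} ?G"
    using assms by (intro Henstock_Kurzweil_Integration.integral_combine[symmetric] simplex_vol_integrable) auto
  moreover have "integral {x - 1..y} ?G = integral {x - 1..y - 1} ?G + integral {y - 1..y} ?G"
    using assms by (intro Henstock_Kurzweil_Integration.integral_combine[symmetric] simplex_vol_integrable) auto
  ultimately show ?thesis by simp
qed

lemma simplex_vol_lipschitz:
  assumes "0 < n" "x \<le> y"
  shows "simplex_vol n y - simplex_vol n x \<le> y - x"
proof -
  obtain k where n: "n = Suc k" using assms(1) gr0_implies_Suc by blast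
  have "integral {x..y} (\<lambda>u. simplex_vol k u - simplex_vol k (u - 1)) \<le> integral {x..y} (\<lambda>_. 1)"
  proof (rule integral_le)
    have "(\<lambda>u. simplex_vol k (u - 1)) integrable_on {x..y}"
      using simplex_vol_mono[of k] by (intro integrable_on_mono_on) (auto simp: mono_on_def mono_def)
    then show "(\<lambda>u. simplex_vol k u - simplex_vol k (u - 1)) integrable_on {x..y}"
      by (intro integrable_diff simplex_vol_integrable)
    show "simplex_vol k u - simplex_vol k (u - 1) \<le> 1" for u
      using simplex_vol_nonneg[of k "u - 1"] simplex_vol_le_1[of k u] by simp
  qed auto
  then show ?thesis using simplex_vol_diff[OF assms(2), of k] assms(2) by (simp add: n)
qed

lemma continuous_simplex_vol: "0 < n \<Longrightarrow> continuous_on A (simplex_vol n)"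
proof (rule lipschitz_on_continuous_on[of 1], rule lipschitz_onI)
  fix x y assume "0 < n"
  then show "dist (simplex_vol n x) (simplex_vol n y) \<le> 1 * dist x y"
    using simplex_vol_lipschitz[of n x y] simplex_vol_lipschitz[of n y x]
      monoD[OF simplex_vol_mono[of n], of x y] monoD[OF simplex_vol_mono[of n], of y x]
    by (cases "x \<le> y") (auto simp: dist_real_def)
qed auto

lemma simplex_vol_0: "0 < n \<Longrightarrow> t \<le> 0 \<Longrightarrow> simplex_vol n t = 0"
proof (rule antisym[OF _ simplex_vol_nonneg], rule field_le_epsilon)
  fix e :: real assume "0 < n" "t \<le> 0" "0 < e"
  then show "simplex_vol n t \<le> 0 + e"
    using simplex_vol_lipschitz[of n "t - e" t] simplex_vol_neg[of "t - e" n] by simp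
qed

lemma simplex_vol_1: "simplex_vol (Suc 0) t = max 0 (min 1 t)"
proof -
  consider "t \<le> 0" | "0 < t" "t < 1" | "1 \<le> t" by linarith
  then show ?thesis
  proof cases
    case 2
    have "integral {t - 1..t} (simplex_vol 0) = integral {t - 1..0} (simplex_vol 0) + integral {0..t} (simplex_vol 0)"
      using 2 by (intro Henstock_Kurzweil_Integration.integral_combine[symmetric] simplex_vol_integrable) auto
    also have "integral {0..t} (simplex_vol 0) = integral {0..t} (\<lambda>_. 1)"
      by (intro integral_cong) auto
    also have "integral {t - 1..0} (simplex_vol 0) = integral {t - 1..0} (\<lambda>_. 0)"
      by (intro integral_spike[of "{0}"]) auto
    finally have "integral {t - 1..t} (simplex_vol 0) = t" using 2 by (simp del: simplex_vol.simps)
    then show ?thesis using 2 by (simp only: simplex_vol.simps(2))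
  qed (simp_all add: simplex_vol_0 simplex_vol_ge del: simplex_vol.simps)
qed

lemma simplex_vol_strict_mono:
  assumes "0 < n" "0 \<le> x" "x < y" "y \<le> real n"
  shows "simplex_vol n x < simplex_vol n y"
  using assms
proof (induction n arbitrary: x y rule: nat_induct_non_zero)
  case 1
  then show ?case using simplex_vol_1[of x] simplex_vol_1[of y] by (simp del: simplex_vol.simps)
next
  case (Suc n)
  let ?g = "\<lambda>u. simplex_vol n u - simplex_vol n (u - 1)"
  have cont: "continuous_on A ?g" for A
    by (rule continuous_on_diff[OF continuous_simplex_vol[OF Suc.hyps]
          continuous_on_compose2[OF continuous_simplex_vol[OF Suc.hyps, of UNIV]]])
       (auto intro: continuous_intros)
  have pos: "0 < ?g u" if "0 < u" "u < real (Suc n)" for u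
  proof (cases "u \<le> real n")
    case True
    have "simplex_vol n (max 0 (u - 1)) < simplex_vol n u"
      using that True by (intro Suc.IH) auto
    moreover have "simplex_vol n (u - 1) \<le> simplex_vol n (max 0 (u - 1))"
      by (intro monoD[OF simplex_vol_mono]) auto
    ultimately show ?thesis by simp
  next
    case False
    have "simplex_vol n (max 0 (u - 1)) < simplex_vol n (real n)"
      using that False Suc.hyps by (intro Suc.IH) auto
    moreover have "simplex_vol n (u - 1) \<le> simplex_vol n (max 0 (u - 1))"
      by (intro monoD[OF simplex_vol_mono]) auto
    ultimately show ?thesis using False by (simp add: simplex_vol_ge)
  qed
  \<comment> \<open>The density is continuous and positive in the interior, so it cannot have integral zero.\<close>
  have "integral {x..y} ?g \<noteq> 0"
  proof
    assume *: "integral {x..y} ?g = 0"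
    have "?g ((x + y)/2) = 0"
    proof (rule has_integral_0_cbox_imp_0[of x y ?g])
      show "(?g has_integral 0) (cbox x y)"
        using * cont by (metis integrable_continuous_interval has_integral_integrable_integral interval_cbox)
      show "0 \<le> ?g u" for u using monoD[OF simplex_vol_mono, of "u-1" u] by simp
    qed (use cont Suc.prems in auto)
    then show False using pos[of "(x + y)/2"] Suc.prems by force
  qed
  moreover have "0 \<le> integral {x..y} ?g"
    using cont monoD[OF simplex_vol_mono, of "u-1" u for u]
    by (intro integral_nonneg integrable_continuous_interval) auto
  ultimately show ?case using simplex_vol_diff[of x y n] Suc.prems by simp
qed

text \<open>Log-concavity in the form used here says that \<open>a (u + \<delta>) / a u\<close> decreases in \<open>u\<close>, cross-multiplied in
order to admit zeros.  The ratio \<open>b (x + \<delta>) / b x\<close> is the mean of this quotient over the window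
\<open>[x - 1, x]\<close> with respect to the weight \<open>a\<close>.  Moving the window to the right replaces a left block by a
right block on which the quotient is smaller, while the common block keeps its share; hence the mean
decreases.\<close>

lemma sliding_window_TP2:
  fixes a :: "real \<Rightarrow> real"
  assumes int: "\<And>x y. a integrable_on {x..y}" and nonneg: "\<And>x. 0 \<le> a x"
    and lc: "\<And>u v \<delta>. u \<le> v \<Longrightarrow> 0 \<le> \<delta> \<Longrightarrow> a (v + \<delta>) * a u \<le> a (u + \<delta>) * a v"
    and xy: "x \<le> y" "0 \<le> \<delta>"
  defines "b \<equiv> \<lambda>x. integral {x - 1..x} a"
  shows "b (y + \<delta>) * b x \<le> b (x + \<delta>) * b y"
proof -
  let ?I = "\<lambda>p q. integral {p..q} a" and ?J = "\<lambda>p q. integral {p + \<delta>..q + \<delta>} a"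
  have J: "?J p q = integral {p..q} (\<lambda>u. a (u + \<delta>))" for p q
    using integral_shift_real_ivl[of "p + \<delta>" "\<delta>" "q + \<delta>" a] by simp
  have int': "(\<lambda>u. a (u + \<delta>)) integrable_on {p..q}" for p q
    using int[of "p + \<delta>" "q + \<delta>"] integrable_on_shift_cbox[of a \<delta> p q] 
    by (simp add: o_def add.commute)
  have Inn: "0 \<le> ?I p q" and Jnn: "0 \<le> ?J p q" for p q
    by (auto intro!: integral_nonneg int nonneg)
  \<comment> \<open>The pointwise inequality, integrated first over the left block and then over the right block.\<close>
  have block: "?J r s * ?I p q \<le> ?J p q * ?I r s" if "q \<le> r" for p q r s
  proof -
    have 1: "a (v + \<delta>) * ?I p q \<le> ?J p q * a v" if "v \<in> {r..s}" for v
    proof -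
      have "integral {p..q} (\<lambda>u. a (v + \<delta>) * a u) \<le> integral {p..q} (\<lambda>u. a (u + \<delta>) * a v)"
        using that \<open>q \<le> r\<close> xy
        by (intro integral_le lc integrable_on_mult_left integrable_on_mult_right int int') auto
      then show ?thesis by (simp add: J)
    qed
    have "integral {r..s} (\<lambda>v. a (v + \<delta>) * ?I p q) \<le> integral {r..s} (\<lambda>v. ?J p q * a v)"
      using 1 by (intro integral_le integrable_on_mult_left integrable_on_mult_right int int') auto
    then show ?thesis by (simp add: J)
  qed
  have comb: "?I p r = ?I p q + ?I q r" "?J p r = ?J p q + ?J q r" if "p \<le> q" "q \<le> r" for p q r
    using that by (auto intro!: Henstock_Kurzweil_Integration.integral_combine[symmetric] int)
  show ?thesis
  proof (cases "x \<le> y - 1")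
    case True
    then show ?thesis using block[of x "y - 1" y "x - 1"] by (simp add: b_def algebra_simps)
  next
    case False
    have "b x = ?I (x - 1) (y - 1) + ?I (y - 1) x" "b y = ?I (y - 1) x + ?I x y"
      "b (x + \<delta>) = ?J (x - 1) (y - 1) + ?J (y - 1) x" "b (y + \<delta>) = ?J (y - 1) x + ?J x y"
      using comb[of "x - 1" "y - 1" x] comb[of "y - 1" x y] False xy
      by (simp_all add: b_def algebra_simps)
    moreover have "?J (y - 1) x * ?I (x - 1) (y - 1) \<le> ?J (x - 1) (y - 1) * ?I (y - 1) x"
      "?J x y * ?I (x - 1) (y - 1) \<le> ?J (x - 1) (y - 1) * ?I x y"
      "?J x y * ?I (y - 1) x \<le> ?J (y - 1) x * ?I x y"
      using False xy by (auto intro!: block)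
    ultimately show ?thesis by (simp add: algebra_simps)
  qed
qed

text \<open>The increment of \<open>simplex_vol (Suc n)\<close> over a step of length \<open>h\<close> is the window average of the increment
in dimension \<open>n\<close>, so the property passes from each dimension to the next.  In dimension \<open>0\<close> the
increment is the indicator of an interval.\<close>

lemma simplex_vol_increments_log_concave:
  assumes "0 \<le> h" "u \<le> v" "0 \<le> \<delta>"
  shows "(simplex_vol n (v + \<delta> + h) - simplex_vol n (v + \<delta>)) * (simplex_vol n (u + h) - simplex_vol n u)
    \<le> (simplex_vol n (u + \<delta> + h) - simplex_vol n (u + \<delta>)) * (simplex_vol n (v + h) - simplex_vol n v)"
  using assms(2,3)
proof (induction n arbitrary: u v \<delta>)
  case 0
  then show ?case using assms(1) by auto
next
  case (Suc n)
  let ?a = "\<lambda>x. simplex_vol n (x + h) - simplex_vol n x"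
  have int': "(\<lambda>x. simplex_vol n (x + h)) integrable_on {p..q}" for p q
    using simplex_vol_mono[of n] by (intro integrable_on_mono_on) (auto simp: mono_on_def mono_def)
  have b: "integral {x - 1..x} ?a = simplex_vol (Suc n) (x + h) - simplex_vol (Suc n) x" for x
    using integral_shift_real_ivl[of "x - 1 + h" h "x + h" "simplex_vol n"] int'
    by (simp add: integral_diff simplex_vol_integrable algebra_simps)
  have "integral {v + \<delta> - 1..v + \<delta>} ?a * integral {u - 1..u} ?a
      \<le> integral {u + \<delta> - 1..u + \<delta>} ?a * integral {v - 1..v} ?a"
    using Suc.prems
  proof (intro sliding_window_TP2)
    show "?a integrable_on {p..q}" for p q by (intro integrable_diff int' simplex_vol_integrable)
    show "0 \<le> ?a p" for p using assms(1) monoD[OF simplex_vol_mono, of p "p + h"] by simp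
  qed (use Suc.IH in \<open>auto simp: algebra_simps\<close>)
  then show ?case unfolding b by (simp add: algebra_simps)
qed

lemma nn_integral_simplex_vol:
  "(\<integral>\<^sup>+s. ennreal (simplex_vol n (t - s)) * indicator {0..1} s \<partial>lborel) = ennreal (simplex_vol (Suc n) t)"
proof -
  let ?f = "\<lambda>s. simplex_vol n (t - s)"
  have m[measurable]: "simplex_vol n \<in> borel_measurable borel"
    by (rule borel_measurable_mono[OF simplex_vol_mono])
  have "(simplex_vol n has_integral simplex_vol (Suc n) t) {t - 1..t}"
    using simplex_vol_integrable[of n "t-1" t] by (simp add: integrable_integral)
  then have "((\<lambda>x. simplex_vol n (x + t)) has_integral simplex_vol (Suc n) t) {-1..-0}"
    using has_integral_shift_real_ivl[of "simplex_vol n" _ "t - 1" t t] by simp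
  then have "((\<lambda>x. simplex_vol n (- x + t)) has_integral simplex_vol (Suc n) t) {0..1}"
    using has_integral_reflect_real[of "\<lambda>x. simplex_vol n (- x + t)" _ 1 0] by (simp del: simplex_vol.simps)
  then have "(?f has_integral simplex_vol (Suc n) t) {0..1}" by (simp del: simplex_vol.simps)
  then have "((\<lambda>s. if s \<in> {0..1} then ?f s else 0) has_integral simplex_vol (Suc n) t) UNIV"
    by (subst has_integral_restrict_UNIV)
  from nn_integral_has_integral_lborel[OF _ _ this] 
  have "(\<integral>\<^sup>+s. ennreal (if s \<in> {0..1} then ?f s else 0) \<partial>lborel) = ennreal (simplex_vol (Suc n) t)"
    by (simp add: simplex_vol_nonneg del: simplex_vol.simps)
  also have "(\<lambda>s. ennreal (if s \<in> {0..1} then ?f s else 0)) = (\<lambda>s. ennreal (?f s) * indicator {0..1} s)"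
    by (auto simp: fun_eq_iff indicator_def)
  finally show ?thesis .
qed

section \<open>Staircases under log-concave weights\<close>

text \<open>Bookkeeping for the next lemma: the bound on \<open>D j\<close> is a part \<open>u j\<close> charged to index \<open>j\<close> and a part
\<open>v (j - 1)\<close> charged to the preceding index.  Collecting all charges at index \<open>i\<close>, one compares
them with a common multiple \<open>q\<close> of \<open>a i * E i\<close>.\<close>

lemma sum_shift_bound:
  fixes a D u v E :: "nat \<Rightarrow> real"
  assumes a: "\<And>j. 1 \<le> j \<Longrightarrow> j \<le> M \<Longrightarrow> 0 \<le> a j" "a (Suc M) = 0"
    and D: "\<And>j. 1 \<le> j \<Longrightarrow> j \<le> M \<Longrightarrow> D j \<le> u j + v (j - 1)"
    and v0: "v 0 = 0" and q: "0 \<le> q"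
    and uv: "\<And>i. 1 \<le> i \<Longrightarrow> i \<le> M \<Longrightarrow> a i * u i + a (Suc i) * v i \<le> q * (a i * E i)"
    and E: "(\<Sum>j=1..M. a j * E j) \<le> 0"
  shows "(\<Sum>j=1..M. a j * D j) \<le> 0"
proof -
  have shift: "(\<Sum>j=1..m. a j * v (j - 1)) + a (Suc m) * v m = (\<Sum>i=1..m. a (Suc i) * v i)" for m
    by (induction m) (auto simp: v0)
  have "(\<Sum>j=1..M. a j * D j) \<le> (\<Sum>j=1..M. a j * u j + a j * v (j - 1))"
    using a(1) D by (intro sum_mono) (auto simp flip: distrib_left intro!: mult_left_mono)
  also have "\<dots> = (\<Sum>i=1..M. a i * u i + a (Suc i) * v i)"
    using shift[of M] a(2) by (simp add: sum.distrib)
  also have "\<dots> \<le> (\<Sum>i=1..M. q * (a i * E i))"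
    using uv by (intro sum_mono) auto
  also have "\<dots> = q * (\<Sum>i=1..M. a i * E i)" by (simp add: sum_distrib_left)
  also have "\<dots> \<le> 0" using E q by (simp add: mult_nonneg_nonpos)
  finally show ?thesis .
qed

text \<open>Here \<open>E j\<close> and \<open>D j\<close> are the deficits of a profile against a comparison profile at level \<open>j\<close>, before and
after a step.  At most levels there are two bounds on \<open>D j\<close>, namely \<open>E (j - 1)\<close> and \<open>E j\<close>; the second
one fails on \<open>L\<close> (nearly full levels) and on \<open>R\<close> (empty levels).  Using \<open>E i\<close> at level \<open>i + 1\<close> multiplies
its weight by \<open>a (i + 1) / a i\<close>, which decreases in \<open>i\<close>.  It suffices to choose the bounds such that, for
some \<open>q\<close>, every negative \<open>E i\<close> is used with a multiplier at least \<open>q\<close> and every positive one with a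
multiplier at most \<open>q\<close>: then the sum of the \<open>a j * D j\<close> is at most \<open>q\<close> times that of the \<open>a j * E j\<close>.

Let \<open>m\<close> be the first index beyond \<open>L\<close> with \<open>E m \<ge> 0\<close>, and \<open>m'\<close> the last one before \<open>R\<close> with
\<open>E m' \<le> 0\<close>.  (If \<open>L\<close> is nonempty and there is no \<open>m\<close>, all \<open>D j\<close> are nonpositive.)  Up to level \<open>m\<close> it suffices to shift the negative deficits, and above \<open>m'\<close> all deficits
are nonnegative.  If the weights decrease from \<open>m - 1\<close> to \<open>m\<close>, let \<open>q < 1\<close> be the quotient of
these weights, and beyond \<open>m\<close> shift the positive deficits but not the negative ones.  If the weights
increase from \<open>m'\<close> to \<open>m' + 1\<close>, a mirror image of this works with a quotient \<open>q > 1\<close>.  Otherwise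
shifting increases the weights below \<open>m\<close> and decreases them above \<open>m'\<close>, and \<open>q = 1\<close> works without
shifts in between.\<close>

lemma log_concave_weighted_deficit:
  fixes a D E :: "nat \<Rightarrow> real" and L R :: "nat set"
  assumes pos: "\<And>j. 1 \<le> j \<Longrightarrow> j \<le> M \<Longrightarrow> 0 < a j" and aM: "a (Suc M) = 0"
    and lc: "\<And>i j. 1 \<le> i \<Longrightarrow> i \<le> j \<Longrightarrow> j \<le> M \<Longrightarrow> a (Suc j) * a i \<le> a (Suc i) * a j"
    and left: "\<And>j. 2 \<le> j \<Longrightarrow> j \<le> M \<Longrightarrow> D j \<le> E (j - 1)"
    and here: "\<And>j. 1 \<le> j \<Longrightarrow> j \<le> M \<Longrightarrow> j \<notin> L \<Longrightarrow> j \<notin> R \<Longrightarrow> D j \<le> E j"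
    and L: "\<And>j. j \<in> L \<Longrightarrow> 1 \<le> j \<and> j \<le> M \<and> E j < 0"
    and L': "\<And>i j. j \<in> L \<Longrightarrow> 1 \<le> i \<Longrightarrow> i \<le> j \<Longrightarrow> D i \<le> 0"
    and R: "\<And>j. j \<in> R \<Longrightarrow> 1 < j \<and> j \<le> M"
    and R': "\<And>i j. j \<in> R \<Longrightarrow> j \<le> i \<Longrightarrow> i \<le> M \<Longrightarrow> 0 \<le> E i"
    and E: "(\<Sum>j=1..M. a j * E j) \<le> 0"
  shows "(\<Sum>j=1..M. a j * D j) \<le> 0"
proof -
  have nonneg: "0 \<le> a j" if "1 \<le> j" "j \<le> Suc M" for j
    using pos[of j] aM that by (cases "j = Suc M") auto
  have finL: "finite L" using L by (meson finite_nat_set_iff_bounded_le)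
  have up: "a i \<le> a (Suc i)" if "1 \<le> i" "i \<le> j" "j \<le> M" "a j \<le> a (Suc j)" for i j
  proof -
    have "a j * a i \<le> a (Suc j) * a i" using that nonneg[of i] by (intro mult_right_mono) auto
    also have "\<dots> \<le> a (Suc i) * a j" using lc[of i j] that by simp
    finally show ?thesis using pos[of j] that by (simp add: mult.commute)
  qed
  have down: "a (Suc j) \<le> a j" if "1 \<le> i" "i \<le> j" "j \<le> M" "a (Suc i) \<le> a i" for i j
  proof -
    have "a (Suc j) * a i \<le> a (Suc i) * a j" using lc[of i j] that by simp
    also have "\<dots> \<le> a i * a j" using that nonneg[of j] by (intro mult_right_mono) auto
    finally show ?thesis using pos[of i] that by (simp add: mult.commute)
  qed
  have nobad: ?thesis if "\<And>j. 1 \<le> j \<Longrightarrow> j \<le> M \<Longrightarrow> D j \<le> 0"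
    using that nonneg by (intro sum_nonpos) (auto intro!: mult_nonneg_nonpos)
  show ?thesis
  proof (cases "L \<noteq> {} \<and> (\<forall>j. Max L < j \<longrightarrow> j \<le> M \<longrightarrow> E j < 0)")
    case True
    define b where "b = Max L"
    have b: "b \<in> L" using True finL b_def by auto
    have neg: "E j < 0" if "b \<le> j" "j \<le> M" for j
      using that True L[OF b] by (cases "j = b") (auto simp: b_def)
    show ?thesis
    proof (rule nobad)
      fix j assume j: "1 \<le> j" "j \<le> M"
      show "D j \<le> 0"
      proof (cases "j \<le> b")
        case True then show ?thesis using L'[OF b] j by auto
      next
        case False
        then have "D j \<le> E (j - 1)" using left[of j] j L[OF b] by auto
        also have "\<dots> < 0" using neg[of "j-1"] False j by auto
        finally show ?thesis by simp
      qed
    qed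
  next
    case notriv: False
    \<comment> \<open>The value 0 for m stands for an empty L.\<close>
    obtain m where m: "m = 0 \<and> L = {} \<or> (2 \<le> m \<and> m \<le> M \<and> 0 \<le> E m \<and> L \<noteq> {} \<and> E (m - 1) < 0)"
      and mD: "\<And>j. 1 \<le> j \<Longrightarrow> j \<le> m \<Longrightarrow> D j \<le> (if j = 1 then 0 else min 0 (E (j - 1)))"
      and mL: "\<And>j. j \<in> L \<Longrightarrow> j < m"
    proof (cases "L = {}")
      case True then show ?thesis using that[of 0] by auto
    next
      case False
      define b where "b = Max L"
      have b: "b \<in> L" "\<And>j. j \<in> L \<Longrightarrow> j \<le> b" using False finL b_def by auto
      define m where "m = (LEAST j. b < j \<and> j \<le> M \<and> 0 \<le> E j)"
      have ex: "\<exists>j. b < j \<and> j \<le> M \<and> 0 \<le> E j" using notriv False unfolding b_def by force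
      have m: "b < m" "m \<le> M" "0 \<le> E m" using LeastI_ex[OF ex] unfolding m_def by auto
      have neg: "E j < 0" if "b \<le> j" "j < m" for j
        using that not_less_Least[of j "\<lambda>j. b < j \<and> j \<le> M \<and> 0 \<le> E j"] L[OF b(1)] m
        by (cases "j = b") (auto simp: m_def)
      show ?thesis
      proof (rule that[of m])
        show "m = 0 \<and> L = {} \<or> (2 \<le> m \<and> m \<le> M \<and> 0 \<le> E m \<and> L \<noteq> {} \<and> E (m - 1) < 0)"
          using m L[OF b(1)] neg[of "m-1"] False by auto
        fix j assume j: "1 \<le> j" "j \<le> m"
        show "D j \<le> (if j = 1 then 0 else min 0 (E (j - 1)))"
        proof (cases "j \<le> b")
          case True
          then show ?thesis using L'[OF b(1), of j] left[of j] j m by auto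
        next
          case False
          then show ?thesis using left[of j] neg[of "j - 1"] j m L[OF b(1)] by auto
        qed
      next
        show "\<And>j. j \<in> L \<Longrightarrow> j < m" using b m by force
      qed
    qed
    \<comment> \<open>The value M for m' stands for an empty R.  Otherwise some deficit before R is
        nonpositive, as the weighted sum would be positive without it.\<close>
    obtain m' where m': "m' = M \<and> R = {} \<or> (1 \<le> m' \<and> m' < M \<and> E m' \<le> 0 \<and> R \<noteq> {})"
      and mE: "\<And>i. m' < i \<Longrightarrow> i \<le> M \<Longrightarrow> 0 \<le> E i"
      and mR: "\<And>j. j \<in> R \<Longrightarrow> m' < j"
      and mneg: "\<And>j. 1 \<le> j \<Longrightarrow> j \<le> M \<Longrightarrow> E j < 0 \<Longrightarrow> j \<le> m'"
    proof (cases "R = {}")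
      case True then show ?thesis using that[of M] by auto
    next
      case False
      define \<alpha> where "\<alpha> = (LEAST j. j \<in> R)"
      have \<alpha>: "\<alpha> \<in> R" "\<And>j. j \<in> R \<Longrightarrow> \<alpha> \<le> j"
        using False unfolding \<alpha>_def by (auto intro: LeastI Least_le)
      define S where "S = {j. 1 \<le> j \<and> j < \<alpha> \<and> E j \<le> 0}"
      have "S \<noteq> {}"
      proof
        assume "S = {}"
        then have *: "0 < E j" if "1 \<le> j" "j < \<alpha>" for j using that unfolding S_def by force
        have "0 < (\<Sum>j=1..M. a j * E j)"
        proof (rule sum_pos2[of _ 1])
          show "0 < a 1 * E 1" using * R[OF \<alpha>(1)] pos[of 1] by auto
          fix i assume "i \<in> {1..M}"
          then show "0 \<le> a i * E i" using *[of i] R'[OF \<alpha>(1), of i] pos[of i]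
            by (cases "i < \<alpha>") auto
        qed (use R[OF \<alpha>(1)] in auto)
        then show False using E by simp
      qed
      have finS: "finite S" unfolding S_def by auto
      define m' where "m' = Max S"
      have m': "m' \<in> S" using Max_in[OF finS \<open>S \<noteq> {}\<close>] m'_def by simp
      have gt: "0 < E j" if "m' < j" "j < \<alpha>" for j
      proof (rule ccontr)
        assume "\<not> 0 < E j"
        then have "j \<in> S" using that m' by (auto simp: S_def)
        then show False using Max_ge[OF finS, of j] that m'_def by auto
      qed
      show ?thesis
      proof (rule that[of m'])
        show "m' = M \<and> R = {} \<or> (1 \<le> m' \<and> m' < M \<and> E m' \<le> 0 \<and> R \<noteq> {})"
          using m' R[OF \<alpha>(1)] False by (auto simp: S_def)
        show *: "0 \<le> E i" if "m' < i" "i \<le> M" for i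
          using gt[of i] R'[OF \<alpha>(1), of i] that by (cases "i < \<alpha>") auto
        show "m' < j" if "j \<in> R" for j using that \<alpha>(2)[OF that] m' by (auto simp: S_def)
        show "j \<le> m'" if "1 \<le> j" "j \<le> M" "E j < 0" for j
          using *[of j] that by (meson leI not_less)
      qed
    qed
    have ok: "D j \<le> E j" if "m < j" "j \<le> m'" "j \<le> M" for j
      using here[of j] mL[of j] mR[of j] that by auto
    consider (A) "2 \<le> m" "a m < a (m - 1)" | (B) "m' < M" "a m' < a (Suc m')"
      | (C) "2 \<le> m \<Longrightarrow> a (m - 1) \<le> a m" "m' < M \<Longrightarrow> a (Suc m') \<le> a m'" by force
    then show ?thesis
    proof cases
      case A
      define q where "q = a m / a (m - 1)"
      have am: "0 < a (m - 1)" "0 < a m" using m A pos by auto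
      have q: "0 \<le> q" "q \<le> 1" using A am by (auto simp: q_def)
      have q1: "q * a i \<le> a (Suc i)" if "1 \<le> i" "i < m" for i
      proof -
        have "Suc (m - 1) = m" "i \<le> m - 1" "m - 1 \<le> M" using that A m by auto
        then have "a m * a i \<le> a (Suc i) * a (m - 1)" using lc[of i "m - 1"] that(1) by metis
        then show ?thesis using am by (simp add: q_def field_simps)
      qed
      have q2: "a (Suc i) \<le> q * a i" if "m \<le> i" "i \<le> M" for i
      proof -
        have "Suc (m - 1) = m" "1 \<le> m - 1" "m - 1 \<le> i" using that A m by auto
        then have "a (Suc i) * a (m - 1) \<le> a m * a i" using lc[of "m - 1" i] that(2) by metis
        then show ?thesis using am by (simp add: q_def field_simps)
      qed
      define u where "u = (\<lambda>j. if m < j then min 0 (E j) else 0)"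
      define v where "v = (\<lambda>i. if i = 0 then 0 else if i < m then min 0 (E i) else max 0 (E i))"
      show ?thesis
      proof (rule sum_shift_bound[where u = u and v = v and q = q, OF _ aM _ _ _ _ E])
        fix j assume j: "1 \<le> j" "j \<le> M"
        show "D j \<le> u j + v (j - 1)"
        proof (cases "j \<le> m")
          case True
          then show ?thesis using mD[of j] j by (auto simp: u_def v_def)
        next
          case False
          then have "D j \<le> E (j - 1)" using left[of j] j A by auto
          moreover have "D j \<le> E j" if "E j < 0" using ok[of j] mneg[of j] that False j by auto
          ultimately show ?thesis using False A by (auto simp: u_def v_def min_def max_def)
        qed
      next
        fix i assume i: "1 \<le> i" "i \<le> M"
        consider "i < m" | "i = m" | "m < i" by linarith
        then show "a i * u i + a (Suc i) * v i \<le> q * (a i * E i)"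
        proof cases
          case 1
          then show ?thesis
            using q1[of i] i mult_right_mono_neg[OF q1[of i], of "E i"] q pos[of i]
            by (auto simp: u_def v_def min_def algebra_simps)
        next
          case 2
          then show ?thesis using mult_right_mono[OF q2[of i], of "E i"] m A i
            by (auto simp: u_def v_def algebra_simps)
        next
          case 3
          show ?thesis
          proof (cases "0 \<le> E i")
            case True
            then show ?thesis using mult_right_mono[OF q2[of i], of "E i"] 3 i
              by (auto simp: u_def v_def algebra_simps)
          next
            case False
            have "a i * E i \<le> q * (a i * E i)"
              using mult_right_mono_neg[OF q(2), of "a i * E i"] False pos[of i] i
              by (simp add: mult_nonneg_nonpos)
            then show ?thesis using 3 i False by (auto simp: u_def v_def)
          qed
        qed
      qed (use nonneg q in \<open>auto simp: v_def\<close>)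
    next
      case B
      then have m1: "1 \<le> m'" "E m' \<le> 0" using m' by auto
      define q where "q = a (Suc m') / a m'"
      have am: "0 < a m'" "0 < a (Suc m')" using m1 B pos by auto
      have q: "1 \<le> q" using B am by (auto simp: q_def)
      have q1: "q * a i \<le> a (Suc i)" if "1 \<le> i" "i \<le> m'" for i
        using lc[of i "m'"] that B am by (auto simp: q_def field_simps)
      have q2: "a (Suc i) \<le> q * a i" if "m' < i" "i \<le> M" for i
        using lc[of "m'" i] that B m1 am by (auto simp: q_def field_simps)
      define u where "u = (\<lambda>j. if j \<le> m' then max 0 (E j) else 0)"
      define v where "v = (\<lambda>i. if i = 0 then 0 else if i \<le> m' then min 0 (E i) else max 0 (E i))"
      show ?thesis
      proof (rule sum_shift_bound[where u = u and v = v and q = q, OF _ aM _ _ _ _ E])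
        fix j assume j: "1 \<le> j" "j \<le> M"
        show "D j \<le> u j + v (j - 1)"
        proof (cases "j \<le> m'")
          case True
          show ?thesis
          proof (cases "j \<le> m")
            case T: True
            then show ?thesis using mD[of j] j True by (auto simp: u_def v_def min_def max_def split: if_splits)
          next
            case False
            then have "D j \<le> E j" using ok[of j] True j by auto
            moreover have "D j \<le> E (j - 1)" if "j \<noteq> 1" using left[of j] that j by auto
            ultimately show ?thesis using True j by (cases "j = 1") (auto simp: u_def v_def min_def max_def)
          qed
        next
          case False
          then have "D j \<le> E (j - 1)" using left[of j] j m1 by auto
          then show ?thesis using False m1 by (cases "j = Suc m'") (auto simp: u_def v_def min_def max_def)
        qed
      next
        fix i assume i: "1 \<le> i" "i \<le> M"
        show "a i * u i + a (Suc i) * v i \<le> q * (a i * E i)"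
        proof (cases "i \<le> m'")
          case True
          show ?thesis
          proof (cases "0 \<le> E i")
            case T: True
            then show ?thesis using mult_right_mono[OF q, of "a i * E i"] pos[of i] i True
              by (auto simp: u_def v_def)
          next
            case False
            then show ?thesis using mult_right_mono_neg[OF q1[of i], of "E i"] i True
              by (auto simp: u_def v_def algebra_simps)
          qed
        next
          case False
          then show ?thesis using mult_right_mono[OF q2[of i], of "E i"] i mE[of i]
            by (auto simp: u_def v_def algebra_simps)
        qed
      qed (use nonneg q in \<open>auto simp: v_def\<close>)
    next
      case C
      \<comment> \<open>The deficit at m - 1 is negative, so m - 1 is not above m'; hence the two shifted ranges are disjoint.\<close>
      have mm: "m - 1 \<le> m'"
      proof (cases "m = 0")
        case False
        then have "1 \<le> m - 1" "m - 1 \<le> M" "E (m - 1) < 0" using m by auto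
        then show ?thesis by (rule mneg)
      qed simp
      define u where "u = (\<lambda>j. if m < j \<and> j \<le> m' then E j else 0)"
      define v where "v = (\<lambda>i. if i = 0 then 0 else if i < m then min 0 (E i)
                              else if m' < i then max 0 (E i) else 0)"
      show ?thesis
      proof (rule sum_shift_bound[where u = u and v = v and q = 1, OF _ aM _ _ _ _ E])
        fix j assume j: "1 \<le> j" "j \<le> M"
        consider "j \<le> m" | "m < j" "j \<le> m'" | "m < j" "m' < j" by linarith
        then show "D j \<le> u j + v (j - 1)"
        proof cases
          case 1 then show ?thesis using mD[of j] j by (auto simp: u_def v_def)
        next
          case 2 then show ?thesis using ok[of j] j by (auto simp: u_def v_def)
        next
          case 3
          then have m1: "1 \<le> m'" "E m' \<le> 0" using m' j by auto
          then have "D j \<le> E (j - 1)" using left[of j] j 3 by auto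
          then show ?thesis using 3 m1 by (cases "j = Suc m'") (auto simp: u_def v_def)
        qed
      next
        fix i assume i: "1 \<le> i" "i \<le> M"
        consider "i < m" | "i = m" "i \<le> m'" | "m < i" "i \<le> m'" | "m \<le> i" "m' < i" by linarith
        then show "a i * u i + a (Suc i) * v i \<le> 1 * (a i * E i)"
        proof cases
          case 1
          then have "2 \<le> m" "i \<le> m - 1" "m - 1 \<le> M" "Suc (m - 1) = m" using m i by auto
          then have "a i \<le> a (Suc i)" using up[of i "m - 1"] C(1) i(1) by metis
          then show ?thesis using 1 i pos[of i] mult_right_mono_neg[of "a i" "a (Suc i)" "E i"]
            by (auto simp: u_def v_def min_def)
        next
          case 2
          then show ?thesis using m i pos[of i] by (auto simp: u_def v_def)
        next
          case 3
          then show ?thesis by (auto simp: u_def v_def)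
        next
          case 4
          then have "1 \<le> m'" "m' \<le> i" "m' < M" using m' i by auto
          then have "a (Suc i) \<le> a i" using down[of m' i] C(2) i(2) by metis
          then show ?thesis using 4 i mE[of i] by (auto simp: u_def v_def intro: mult_right_mono)
        qed
      qed (use nonneg in \<open>auto simp: v_def\<close>)
    qed
  qed
qed

text \<open>The profile \<open>x\<close> grows in both directions: each level inherits the length of the level below it, and every
nonempty level grows by \<open>h\<close> until it has length one.  The staircase \<open>z r\<close> gains exactly as much in both
ways, except where it is truncated.  The sideways growth can fall short of that of the staircase only at
levels longer than \<open>1 - h\<close>, where the length saturates, and at empty levels, which do not grow on their
own; these are the exceptional sets of the preceding lemma.\<close>

lemma staircase_growth:
  fixes a x y :: "nat \<Rightarrow> real" and h :: real and r :: nat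
  defines "z \<equiv> \<lambda>(r::nat) (j::nat). max 0 (min 1 (h * (real r - real j)))"
  assumes h: "0 \<le> h"
    and pos: "\<And>j. 1 \<le> j \<Longrightarrow> j \<le> M \<Longrightarrow> 0 < a j" and aM: "a (Suc M) = 0"
    and lc: "\<And>i j. 1 \<le> i \<Longrightarrow> i \<le> j \<Longrightarrow> j \<le> M \<Longrightarrow> a (Suc j) * a i \<le> a (Suc i) * a j"
    and anti: "\<And>i j. i \<le> j \<Longrightarrow> x j \<le> x i" and x0: "\<And>j. 0 \<le> x j" and x1: "0 < x 1"
    and y_shift: "\<And>j. 1 \<le> j \<Longrightarrow> x j \<le> y (Suc j)"
    and y_grow: "\<And>j. 1 \<le> j \<Longrightarrow> 0 < x j \<Longrightarrow> min 1 (x j + h) \<le> y j"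
    and start: "(\<Sum>j=1..M. a j * z r j) \<le> (\<Sum>j=1..M. a j * x j)"
  shows "(\<Sum>j=1..M. a j * z (Suc r) j) \<le> (\<Sum>j=1..M. a j * y j)"
proof -
  define E where "E = (\<lambda>j. z r j - x j)"
  define D where "D = (\<lambda>j. z (Suc r) j - y j)"
  define L where "L = {j. 1 \<le> j \<and> j \<le> M \<and> E j < 0 \<and> 1 - h < x j}"
  define R where "R = {j. 1 \<le> j \<and> j \<le> M \<and> x j = 0}"
  have z_shift: "z (Suc r) (Suc j) = z r j" for j by (simp add: z_def)
  have z_step: "z (Suc r) j \<le> z r j + h" for j
  proof -
    have "h * (real (Suc r) - real j) = h * (real r - real j) + h" by (simp add: algebra_simps)
    then show ?thesis unfolding z_def using h by linarith
  qed
  have z01: "0 \<le> z s j" "z s j \<le> 1" for s j by (auto simp: z_def)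
  have "(\<Sum>j=1..M. a j * D j) \<le> 0"
  proof (rule log_concave_weighted_deficit[where a = a and D = D and E = E and L = L and R = R,
        OF pos aM lc])
    fix j :: nat assume "2 \<le> j"
    then show "D j \<le> E (j - 1)"
      using y_shift[of "j - 1"] z_shift[of "j - 1"] by (simp add: D_def E_def)
  next
    fix j assume j: "1 \<le> j" "j \<le> M" "j \<notin> L" "j \<notin> R"
    then have xj: "0 < x j" using x0[of j] by (auto simp: R_def less_le)
    have "E j < 0 \<Longrightarrow> x j \<le> 1 - h" using j by (auto simp: L_def)
    then consider "x j \<le> 1 - h" | "1 - h < x j" "0 \<le> E j" by linarith
    then show "D j \<le> E j"
    proof cases
      case 1
      then show ?thesis using y_grow[OF j(1) xj] z_step[of j] by (simp add: D_def E_def)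
    next
      case 2
      then show ?thesis using y_grow[OF j(1) xj] z01[of "Suc r" j] by (simp add: D_def E_def)
    qed
  next
    fix i j assume "j \<in> L" and i: "1 \<le> i" "i \<le> j"
    then have "1 - h < x i" "0 < x i" using anti[of i j] z01[of r j] by (auto simp: L_def E_def)
    then show "D i \<le> 0" using y_grow[OF i(1)] z01[of "Suc r" i] by (simp add: D_def)
  next
    fix j assume "j \<in> R"
    then show "1 < j \<and> j \<le> M" using x1 by (cases "j = 1") (auto simp: R_def)
  next
    fix i j assume "j \<in> R" "j \<le> i"
    then have "x i = 0" using anti[of j i] x0[of i] by (auto simp: R_def)
    then show "0 \<le> E i" using z01 by (simp add: E_def)
  next
    show "(\<Sum>j=1..M. a j * E j) \<le> 0"
      using start by (simp add: E_def right_diff_distrib sum_subtractf)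
  qed (auto simp: L_def)
  then show ?thesis by (simp add: D_def right_diff_distrib sum_subtractf)
qed

section \<open>Subsets of the unit interval and their layers\<close>

text \<open>If some point \<open>w\<close> of the interval is missed by \<open>S'\<close>, then \<open>S\<close> stays away from \<open>w\<close> by more than \<open>h\<close>
on both sides.  Hence next to the supremum of the part of \<open>S\<close> on the left of \<open>w\<close>, or, if that part is
empty, next to the infimum of \<open>S\<close>, there is an interval of length \<open>h\<close> inside \<open>S'\<close> that is disjoint
from \<open>S\<close>.\<close>

lemma interval_enlargement:
  fixes S S' :: "real set"
  assumes meas: "S \<in> sets lborel" "S' \<in> sets lborel" and sub: "S \<subseteq> {0..1}" "S' \<subseteq> {0..1}"
    and ne: "S \<noteq> {}" and h: "0 \<le> h"
    and nbh: "\<And>s x. s \<in> S \<Longrightarrow> x \<in> {0..1} \<Longrightarrow> \<bar>x - s\<bar> \<le> h \<Longrightarrow> x \<in> S'"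
  shows "min 1 (measure lborel S + h) \<le> measure lborel S'"
proof (cases "S' = {0..1}")
  case True
  then show ?thesis by simp
next
  case False
  then obtain w where w: "w \<in> {0..1}" "w \<notin> S'" using sub by blast
  have far: "s < w - h \<or> w + h < s" if "s \<in> S" for s
  proof (rule ccontr)
    assume "\<not> ?thesis"
    then have "\<bar>w - s\<bar> \<le> h" by auto
    then show False using nbh[OF that, of w] w by blast
  qed
  have SS': "S \<subseteq> S'"
  proof
    fix s assume "s \<in> S"
    then show "s \<in> S'" using nbh[of s s] sub(1) h by auto
  qed
  have fm: "A \<in> fmeasurable lborel" if "A \<in> sets lborel" "A \<subseteq> {0..1}" for A :: "real set"
  proof (rule fmeasurableI2[OF _ that(2,1)])
    show "{0..1::real} \<in> fmeasurable lborel" by (simp add: fmeasurable_def)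
  qed
  have *: "measure lborel S + h \<le> measure lborel S'" 
    if "p + h = q" "{p<..<q} \<inter> S = {}" "{p<..<q} \<subseteq> S'" for p q
  proof -
    have "measure lborel S + h = measure lborel S + measure lborel {p<..<q}" using that h by simp
    also have "\<dots> = measure lborel (S \<union> {p<..<q})"
    proof (rule measure_Union[symmetric])
      show "emeasure lborel S \<noteq> \<infinity>" using fm[OF meas(1) sub(1)] by (simp add: fmeasurableD2)
      show "emeasure lborel {p<..<q} \<noteq> \<infinity>" using that h by simp
    qed (use that meas in auto)
    also have "\<dots> \<le> measure lborel S'"
      using that(3) SS' meas by (intro measure_mono_fmeasurable fm sub) auto
    finally show ?thesis .
  qed
  have "measure lborel S + h \<le> measure lborel S'"
  proof (cases "\<exists>s\<in>S. s < w")
    case True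
    let ?T = "{s \<in> S. s < w}"
    define p where "p = Sup ?T"
    have T: "?T \<noteq> {}" "bdd_above ?T" using True by (auto intro: bdd_aboveI[of _ w])
    have pw: "p \<le> w - h" unfolding p_def
    proof (rule cSup_least[OF T(1)])
      fix s assume "s \<in> ?T" then show "s \<le> w - h" using far[of s] h by auto
    qed
    have up: "s \<le> p" if "s \<in> S" "s < w" for s
      unfolding p_def using that by (intro cSup_upper T) auto
    have p0: "0 \<le> p" using True up sub by fastforce
    show ?thesis
    proof (rule *[of p "p + h"])
      show "{p<..<p + h} \<inter> S = {}"
      proof -
        have "s \<notin> {p<..<p + h}" if "s \<in> S" for s
          using up[OF that] far[OF that] pw h by (cases "s < w") auto
        then show ?thesis by blast
      qed
      show "{p<..<p + h} \<subseteq> S'"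
      proof
        fix x assume x: "x \<in> {p<..<p + h}"
        then obtain s where s: "s \<in> ?T" "x - h < s"
          using less_cSupD[OF T(1), of "x - h"] by (auto simp: p_def)
        then have "s \<in> S" "s \<le> p" using up by auto
        then show "x \<in> S'" using x s(2) p0 pw w by (intro nbh[of s]) auto
      qed
    qed simp
  next
    case False
    have wS: "w + h \<le> s" if "s \<in> S" for s using far[OF that] False h that by force
    define q where "q = Inf S"
    have T: "bdd_below S" using wS by (rule bdd_belowI)
    have low: "q \<le> s" if "s \<in> S" for s unfolding q_def using that by (rule cInf_lower[OF _ T])
    have pw: "w + h \<le> q" unfolding q_def by (rule cInf_greatest[OF ne wS])
    have q1: "q \<le> 1" using ne low sub by fastforce
    show ?thesis
    proof (rule *[of "q - h" q])
      show "{q - h<..<q} \<inter> S = {}"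
        using low by fastforce
      show "{q - h<..<q} \<subseteq> S'"
      proof
        fix x assume x: "x \<in> {q - h<..<q}"
        then obtain s where s: "s \<in> S" "s < x + h"
          using cInf_lessD[OF ne, of "x + h"] by (auto simp: q_def)
        then have "q \<le> s" using low by auto
        then show "x \<in> S'" using x s q1 pw w by (intro nbh[of s]) auto
      qed
    qed simp
  qed
  then show ?thesis by simp
qed

text \<open>The increments telescope up to the last threshold \<open>G J\<close> not exceeding \<open>v\<close>.\<close>

lemma layer_sum:
  fixes G :: "nat \<Rightarrow> real"
  assumes "G 0 = 0" "mono G"
  shows "\<exists>J\<le>M. (\<Sum>j=1..M. (G j - G (j - 1)) * (if G j \<le> v then 1 else 0)) = G J 
     \<and> (J = 0 \<or> G J \<le> v) \<and> (J = M \<or> v < G (Suc J))"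
proof (induction M)
  case 0
  then show ?case using assms by simp
next
  case (Suc M)
  then obtain J where J: "J \<le> M" "(\<Sum>j=1..M. (G j - G (j - 1)) * (if G j \<le> v then 1 else 0)) = G J"
    "J = 0 \<or> G J \<le> v" "J = M \<or> v < G (Suc J)" by auto
  show ?case
  proof (cases "G (Suc M) \<le> v")
    case True
    have "J = M"
    proof (rule ccontr)
      assume "J \<noteq> M"
      then have "v < G (Suc J)" "G (Suc J) \<le> G (Suc M)" using J monoD[OF assms(2)] by auto
      then show False using True by simp
    qed
    then show ?thesis using J True by (intro exI[of _ "Suc M"]) auto
  next
    case False
    then show ?thesis using J by (intro exI[of _ J]) auto
  qed
qed

text \<open>A discrete layer-cake formula: the sum over the layers is the integral of \<open>f\<close> rounded down to the
thresholds \<open>G j\<close>, and the rounding costs at most the mesh \<open>h\<close>.\<close>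

lemma layer_integral:
  fixes G :: "nat \<Rightarrow> real" and f :: "real \<Rightarrow> real"
  assumes G: "G 0 = 0" "mono G" "G M = 1" "\<And>j. G (Suc j) - G j \<le> h"
    and f[measurable]: "f \<in> borel_measurable borel" and f01: "\<And>s. 0 \<le> f s" "\<And>s. f s \<le> 1"
    and V: "ennreal V = (\<integral>\<^sup>+s. ennreal (f s) * indicator {0..1} s \<partial>lborel)" "0 \<le> V"
  defines "T \<equiv> \<Sum>j=1..M. (G j - G (j - 1)) * measure lborel {s \<in> {0..1}. G j \<le> f s}"
  shows "T \<le> V" "V \<le> T + h"
proof -
  let ?A = "\<lambda>j. {s \<in> {0..1}. G j \<le> f s}"
  have A[measurable]: "?A j \<in> sets lborel" for j by measurable
  have Afin: "emeasure lborel (?A j) < \<infinity>" for j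
    by (rule le_less_trans[OF emeasure_mono[of _ "{0..1}"]]) auto
  have h: "0 \<le> h" using G(4)[of 0] monoD[OF G(2), of 0 "Suc 0"] by linarith
  let ?F = "\<lambda>s. indicator {0..1} s * f s" 
  let ?g = "\<lambda>s. \<Sum>j=1..M. (G j - G (j - 1)) * indicator (?A j) s :: real"
  have intA: "integrable lborel (indicator (?A j) :: real \<Rightarrow> real)" for j
    using Afin by (intro integrable_real_indicator) auto
  have int1: "integrable lborel (indicator {0..1} :: real \<Rightarrow> real)"
    by (intro integrable_real_indicator) auto
  have intF: "integrable lborel ?F"
    by (rule Bochner_Integration.integrable_bound[OF int1]) (auto simp: indicator_def f01)
  have intg: "integrable lborel ?g" by (intro Bochner_Integration.integrable_sum integrable_mult_right intA)
  have "V = enn2real (\<integral>\<^sup>+s. ennreal (?F s) \<partial>lborel)"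
    using V by (metis (no_types, lifting) enn2real_ennreal ennreal_indicator ennreal_mult'' f01(1) indicator_pos_le mult.commute nn_integral_cong)
  also have "\<dots> = (\<integral>s. ?F s \<partial>lborel)"
    by (rule integral_eq_nn_integral[symmetric]) (auto simp: f01)
  finally have VF: "V = (\<integral>s. ?F s \<partial>lborel)" .
  have Tg: "T = (\<integral>s. ?g s \<partial>lborel)"
  proof -
    define A where "A = ?A"
    have "(\<integral>s. ?g s \<partial>lborel) = (\<Sum>j=1..M. (\<integral>s. (G j - G (j - 1)) * indicator (A j) s \<partial>lborel))"
      unfolding A_def by (intro Bochner_Integration.integral_sum integrable_mult_right intA)
    also have "\<dots> = (\<Sum>j=1..M. (G j - G (j - 1)) * measure lborel (A j))"
      by (simp add: integral_indicator)
    finally show ?thesis unfolding T_def A_def by simp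
  qed
  have pt: "?g s \<le> ?F s \<and> ?F s \<le> ?g s + h * indicator {0..1} s" for s
  proof (cases "s \<in> {0..1}")
    case True
    obtain J where J: "J \<le> M" "(\<Sum>j=1..M. (G j - G (j - 1)) * (if G j \<le> f s then 1 else 0)) = G J"
      "J = 0 \<or> G J \<le> f s" "J = M \<or> f s < G (Suc J)"
      using layer_sum[OF G(1,2), of M "f s"] by auto
    have "?g s = (\<Sum>j=1..M. (G j - G (j - 1)) * (if G j \<le> f s then 1 else 0))"
      using True by (intro sum.cong) (auto simp: indicator_def)
    then have gJ: "?g s = G J" using J(2) by simp
    have "G J \<le> f s" using J(3) G(1) f01(1)[of s] by auto
    moreover have "f s \<le> G J + h"
      using J(4)
    proof
      assume "J = M" then show ?thesis using G(3) f01(2)[of s] h by simp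
    next
      assume "f s < G (Suc J)" then show ?thesis using G(4)[of J] by simp
    qed
    ultimately show ?thesis using gJ True by simp
  next
    case False
    then have g0: "?g s = 0" by (intro sum.neutral) auto
    show ?thesis unfolding g0 using False by simp
  qed
  show "T \<le> V" unfolding VF Tg using pt by (intro integral_mono intg intF) auto
  have "V \<le> (\<integral>s. ?g s + h * indicator {0..1} s \<partial>lborel)"
    unfolding VF using pt int1 by (intro integral_mono intF Bochner_Integration.integrable_add intg integrable_mult_right) auto
  also have "\<dots> = T + h"
    unfolding Tg using int1 intg by (subst Bochner_Integration.integral_add) auto
  finally show "V \<le> T + h" .
qed

section \<open>Sublevel sets in product cubes\<close>

text \<open>The cube \<open>[0,1]^I\<close> for a finite set \<open>I\<close> of coordinates.  Coordinates range over an arbitrary set rather than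
a type, so that one can be added at a time; functions are extensional, as the points of a product measure
space are.\<close>

definition box_on :: "'i set \<Rightarrow> ('i \<Rightarrow> real) set" where
  "box_on I = (\<Pi>\<^sub>E i\<in>I. {0..1})"

definition sublevel_vol :: "'i set \<Rightarrow> (('i \<Rightarrow> real) \<Rightarrow> real) \<Rightarrow> real \<Rightarrow> real" where
  "sublevel_vol I \<phi> c = measure (\<Pi>\<^sub>M i\<in>I. lborel) {x \<in> box_on I. \<phi> x \<le> c}"

text \<open>The one-sided bound gives the bound on the absolute value by exchanging \<open>x\<close> and \<open>y\<close>.  Measurability is
part of the definition because \<open>\<phi>\<close> is unrestricted outside the box.\<close>

definition l1_Lipschitz_on_box :: "'i set \<Rightarrow> (('i \<Rightarrow> real) \<Rightarrow> real) \<Rightarrow> bool" where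
  "l1_Lipschitz_on_box I \<phi> \<longleftrightarrow> \<phi> \<in> borel_measurable (\<Pi>\<^sub>M i\<in>I. lborel) \<and>
    (\<forall>x\<in>box_on I. \<forall>y\<in>box_on I. \<phi> x - \<phi> y \<le> (\<Sum>i\<in>I. \<bar>x i - y i\<bar>))"

interpretation lborel_product: product_sigma_finite "\<lambda>_. lborel :: real measure" ..

lemma box_on_sets: "finite I \<Longrightarrow> box_on I \<in> sets (\<Pi>\<^sub>M i\<in>I. (lborel :: real measure))"
  unfolding box_on_def by (intro sets_PiM_I_finite) auto

lemma emeasure_box_on: "finite I \<Longrightarrow> emeasure (\<Pi>\<^sub>M i\<in>I. (lborel :: real measure)) (box_on I) = 1"
  unfolding box_on_def by (subst lborel_product.emeasure_PiM) auto

lemma sublevel_sets: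
  fixes \<phi> :: "('i \<Rightarrow> real) \<Rightarrow> real"
  assumes "finite I" "\<phi> \<in> borel_measurable (\<Pi>\<^sub>M i\<in>I. (lborel :: real measure))"
  shows "{x \<in> box_on I. \<phi> x \<le> c} \<in> sets (\<Pi>\<^sub>M i\<in>I. lborel)"
proof -
  have "{x \<in> box_on I. \<phi> x \<le> c} = box_on I \<inter> {x \<in> space (\<Pi>\<^sub>M i\<in>I. lborel). \<phi> x \<le> c}"
    using sets.sets_into_space[OF box_on_sets[OF assms(1)]] by auto
  moreover have "{x \<in> space (\<Pi>\<^sub>M i\<in>I. lborel). \<phi> x \<le> c} \<in> sets (\<Pi>\<^sub>M i\<in>I. lborel)"
    by (intro borel_measurable_le assms(2) borel_measurable_const)
  ultimately show ?thesis using box_on_sets[OF assms(1)] by simp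
qed

lemma emeasure_sublevel:
  assumes "finite I" "\<phi> \<in> borel_measurable (\<Pi>\<^sub>M i\<in>I. (lborel :: real measure))"
  shows "emeasure (\<Pi>\<^sub>M i\<in>I. lborel) {x \<in> box_on I. \<phi> x \<le> c} = ennreal (sublevel_vol I \<phi> c)"
    and "sublevel_vol I \<phi> c \<le> 1"
proof -
  have le: "emeasure (\<Pi>\<^sub>M i\<in>I. lborel) {x \<in> box_on I. \<phi> x \<le> c} \<le> 1"
    using emeasure_mono[OF _ box_on_sets[OF assms(1)], of "{x \<in> box_on I. \<phi> x \<le> c}"]
    by (auto simp: emeasure_box_on[OF assms(1)])
  then have "emeasure (\<Pi>\<^sub>M i\<in>I. lborel) {x \<in> box_on I. \<phi> x \<le> c} < \<infinity>"
    by (rule le_less_trans) simp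
  then show eq: "emeasure (\<Pi>\<^sub>M i\<in>I. lborel) {x \<in> box_on I. \<phi> x \<le> c} = ennreal (sublevel_vol I \<phi> c)"
    unfolding sublevel_vol_def by (intro emeasure_eq_ennreal_measure) auto
  show "sublevel_vol I \<phi> c \<le> 1" using le unfolding eq by simp
qed

lemma sublevel_vol_nonneg: "0 \<le> sublevel_vol I \<phi> c"
  by (simp add: sublevel_vol_def)

lemma sublevel_vol_mono:
  assumes "finite I" "\<psi> \<in> borel_measurable (\<Pi>\<^sub>M i\<in>I. (lborel :: real measure))"
    "\<phi> \<in> borel_measurable (\<Pi>\<^sub>M i\<in>I. (lborel :: real measure))"
    and "\<And>x. x \<in> box_on I \<Longrightarrow> \<phi> x \<le> c \<Longrightarrow> \<psi> x \<le> d"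
  shows "sublevel_vol I \<phi> c \<le> sublevel_vol I \<psi> d"
proof -
  have "emeasure (\<Pi>\<^sub>M i\<in>I. lborel) {x \<in> box_on I. \<phi> x \<le> c} \<le> emeasure (\<Pi>\<^sub>M i\<in>I. lborel) {x \<in> box_on I. \<psi> x \<le> d}"
    using assms by (intro emeasure_mono sublevel_sets) auto
  then show ?thesis using assms by (simp add: emeasure_sublevel sublevel_vol_nonneg)
qed

text \<open>Fubini along the coordinate \<open>i\<close>, together with the measurability statements that make the slices
available for the induction on the dimension.\<close>

lemma sublevel_vol_insert:
  assumes I: "finite I" "i \<notin> I" and \<phi>[measurable]: "\<phi> \<in> borel_measurable (\<Pi>\<^sub>M i\<in>insert i I. (lborel :: real measure))"
  shows "ennreal (sublevel_vol (insert i I) \<phi> c)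
      = (\<integral>\<^sup>+s. ennreal (sublevel_vol I (\<lambda>x. \<phi> (x(i := s))) c) * indicator {0..1} s \<partial>lborel)"
    and "(\<lambda>s. sublevel_vol I (\<lambda>x. \<phi> (x(i := s))) c) \<in> borel_measurable borel"
    and "\<And>s. (\<lambda>x. \<phi> (x(i := s))) \<in> borel_measurable (\<Pi>\<^sub>M i\<in>I. lborel)"
proof -
  let ?P = "\<Pi>\<^sub>M i\<in>I. (lborel :: real measure)" and ?Q = "\<Pi>\<^sub>M i\<in>insert i I. (lborel :: real measure)"
  interpret finite_product_sigma_finite "\<lambda>_. lborel :: real measure" I by standard (rule I)
  show slice: "\<And>s. (\<lambda>x. \<phi> (x(i := s))) \<in> borel_measurable ?P"
  proof -
    fix s
    have "(\<lambda>x. x(i := s)) \<in> measurable ?P ?Q"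
      by (rule measurable_fun_upd[where J = I]) auto
    then show "(\<lambda>x. \<phi> (x(i := s))) \<in> borel_measurable ?P" by (rule measurable_compose[OF _ \<phi>])
  qed
  let ?A = "{x \<in> box_on (insert i I). \<phi> x \<le> c}"
  have [measurable]: "?A \<in> sets ?Q" using I by (intro sublevel_sets \<phi>) auto
  have eq: "(\<integral>\<^sup>+ x. indicator ?A (x(i := s)) \<partial>?P)
      = ennreal (sublevel_vol I (\<lambda>x. \<phi> (x(i := s))) c) * indicator {0..1} s" for s
  proof -
    have "(\<integral>\<^sup>+ x. indicator ?A (x(i := s)) \<partial>?P)
      = (\<integral>\<^sup>+ x. indicator {x \<in> box_on I. \<phi> (x(i := s)) \<le> c} x * indicator {0..1} s \<partial>?P)"
    proof (rule nn_integral_cong)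
      fix x assume x: "x \<in> space ?P"
      then have "x(i := s) \<in> box_on (insert i I) \<longleftrightarrow> x \<in> box_on I \<and> s \<in> {0..1}"
        using I by (auto simp: box_on_def space_PiM PiE_iff extensional_def)
      then show "(indicator ?A (x(i := s)) :: ennreal)
          = indicator {x \<in> box_on I. \<phi> (x(i := s)) \<le> c} x * indicator {0..1} s"
        by (auto simp: indicator_def)
    qed
    also have "\<dots> = emeasure ?P {x \<in> box_on I. \<phi> (x(i := s)) \<le> c} * indicator {0..1} s"
      using sublevel_sets[OF I(1) slice] by (simp add: nn_integral_multc)
    finally show ?thesis using emeasure_sublevel[OF I(1) slice] by simp
  qed
  have "ennreal (sublevel_vol (insert i I) \<phi> c) = emeasure ?Q ?A"
    using I by (intro emeasure_sublevel(1)[symmetric] \<phi>) auto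
  also have "\<dots> = (\<integral>\<^sup>+ x. indicator ?A x \<partial>?Q)" by simp
  also have "\<dots> = (\<integral>\<^sup>+ s. \<integral>\<^sup>+ x. indicator ?A (x(i := s)) \<partial>?P \<partial>lborel)"
    by (rule lborel_product.product_nn_integral_insert_rev[OF I]) measurable
  finally show "ennreal (sublevel_vol (insert i I) \<phi> c)
      = (\<integral>\<^sup>+s. ennreal (sublevel_vol I (\<lambda>x. \<phi> (x(i := s))) c) * indicator {0..1} s \<partial>lborel)"
    unfolding eq .
  let ?B = "{z \<in> space (lborel \<Otimes>\<^sub>M ?P). snd z \<in> box_on I \<and> \<phi> ((snd z)(i := fst z)) \<le> c}"
  have [measurable]: "box_on I \<in> sets ?P" by (rule box_on_sets[OF I(1)])
  have [measurable]: "(\<lambda>z. (snd z)(i := fst z)) \<in> measurable (lborel \<Otimes>\<^sub>M ?P) ?Q"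
    by (rule measurable_fun_upd[where J = I]) auto
  have "?B \<in> sets (lborel \<Otimes>\<^sub>M ?P)" by measurable
  then have "(\<lambda>s. emeasure ?P (Pair s -` ?B)) \<in> borel_measurable lborel"
    by (rule measurable_emeasure_Pair)
  moreover have "Pair s -` ?B = {x \<in> box_on I. \<phi> (x(i := s)) \<le> c}" for s
    using sets.sets_into_space[OF box_on_sets[OF I(1)]] by (auto simp: space_pair_measure)
  ultimately have "(\<lambda>s. emeasure ?P {x \<in> box_on I. \<phi> (x(i := s)) \<le> c}) \<in> borel_measurable lborel" by simp
  then have "(\<lambda>s. enn2real (emeasure ?P {x \<in> box_on I. \<phi> (x(i := s)) \<le> c})) \<in> borel_measurable lborel"
    by measurable
  then show "(\<lambda>s. sublevel_vol I (\<lambda>x. \<phi> (x(i := s))) c) \<in> borel_measurable borel"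
    by (simp add: sublevel_vol_def measure_def)
qed

text \<open>Slicing the simplex reproduces the recursion that defines \<open>simplex_vol\<close>.\<close>

lemma simplex_vol_eq_sublevel_vol:
  assumes "finite I" shows "sublevel_vol I (\<lambda>x. \<Sum>i\<in>I. x i) t = simplex_vol (card I) t"
  using assms
proof (induction arbitrary: t)
  case empty
  show ?case
  proof (cases "0 \<le> t")
    case True
    then show ?thesis using emeasure_box_on[of "{} :: 'a set"] by (simp add: sublevel_vol_def measure_def)
  qed (simp add: sublevel_vol_def)
next
  case (insert i I)
  have m: "(\<lambda>x. \<Sum>j\<in>J. x j) \<in> borel_measurable (\<Pi>\<^sub>M i\<in>J. (lborel :: real measure))" for J :: "'a set"
    by (intro borel_measurable_sum measurable_component_singleton[THEN measurable_compose]) auto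
  have slice: "sublevel_vol I (\<lambda>x. \<Sum>j\<in>insert i I. (x(i := s)) j) t = simplex_vol (card I) (t - s)" for s
  proof -
    have "(\<Sum>j\<in>insert i I. (x(i := s)) j) = s + (\<Sum>j\<in>I. x j)" for x :: "'a \<Rightarrow> real"
      using insert.hyps by (auto intro!: sum.cong)
    then have "sublevel_vol I (\<lambda>x. \<Sum>j\<in>insert i I. (x(i := s)) j) t = sublevel_vol I (\<lambda>x. \<Sum>j\<in>I. x j) (t - s)"
      by (auto simp: sublevel_vol_def algebra_simps intro!: arg_cong[where f = "measure _"])
    then show ?thesis using insert.IH by simp
  qed
  have "ennreal (sublevel_vol (insert i I) (\<lambda>x. \<Sum>j\<in>insert i I. x j) t)
     = (\<integral>\<^sup>+s. ennreal (simplex_vol (card I) (t - s)) * indicator {0..1} s \<partial>lborel)"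
    using sublevel_vol_insert(1)[OF insert.hyps m] by (simp only: slice)
  also have "\<dots> = ennreal (simplex_vol (Suc (card I)) t)" by (rule nn_integral_simplex_vol)
  finally show ?case using insert.hyps
    by (simp add: sublevel_vol_nonneg simplex_vol_nonneg del: simplex_vol.simps)
qed

section \<open>Corner simplices are isoperimetric\<close>

text \<open>Sublevel sets of a 1-Lipschitz function grow at least as fast as corner simplices.  The restriction
\<open>0 < t\<close> makes the set \<open>{\<phi> \<le> c}\<close> have positive volume; for \<open>t \<le> 0\<close> the premise would hold for
empty sets, which do not grow.\<close>

definition simplex_isoperimetric :: "'i set \<Rightarrow> bool" where
  "simplex_isoperimetric I \<longleftrightarrow> (\<forall>\<phi> c t H. l1_Lipschitz_on_box I \<phi> \<longrightarrow> 0 < t \<longrightarrow> 0 \<le> H \<longrightarrow>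
     simplex_vol (card I) t \<le> sublevel_vol I \<phi> c \<longrightarrow>
     simplex_vol (card I) (t + H) \<le> sublevel_vol I \<phi> (c + H))"

lemma simplex_isoperimetric_singleton: "simplex_isoperimetric {i}"
  unfolding simplex_isoperimetric_def
proof (intro allI impI)
  fix \<phi> :: "('a \<Rightarrow> real) \<Rightarrow> real" and c t H :: real
  assume \<phi>: "l1_Lipschitz_on_box {i} \<phi>" and t: "0 < t" and H: "0 \<le> H"
    and vol: "simplex_vol (card {i}) t \<le> sublevel_vol {i} \<phi> c"
  define e where "e = (\<lambda>(s :: real) j. if j = i then s else undefined :: real)"
  have meas: "\<phi> \<in> borel_measurable (\<Pi>\<^sub>M i\<in>{i}. lborel)" using \<phi> by (simp add: l1_Lipschitz_on_box_def)
  have e: "e s \<in> box_on {i} \<longleftrightarrow> s \<in> {0..1}" for s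
    by (auto simp: e_def box_on_def PiE_iff extensional_def)
  define S where "S = (\<lambda>c. {s \<in> {0..1}. \<phi> (e s) \<le> c})"
  have me: "e \<in> measurable lborel (\<Pi>\<^sub>M i\<in>{i}. lborel)"
    unfolding e_def by (rule measurable_PiM_single') (auto simp: extensional_def PiE_iff)
  have S_meas: "S c \<in> sets lborel" for c
  proof -
    have "(\<lambda>s. \<phi> (e s)) \<in> borel_measurable lborel" by (rule measurable_compose[OF me meas])
    then show ?thesis unfolding S_def by measurable
  qed
  have S_vol: "sublevel_vol {i} \<phi> c = measure lborel (S c)" for c
  proof -
    have "ennreal (sublevel_vol {i} \<phi> c) = (\<integral>\<^sup>+x. indicator {x \<in> box_on {i}. \<phi> x \<le> c} x \<partial>(\<Pi>\<^sub>M i\<in>{i}. lborel))"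
      using sublevel_sets[OF _ meas] emeasure_sublevel(1)[OF _ meas] by simp
    also have "\<dots> = (\<integral>\<^sup>+x. indicator (S c) (x i) \<partial>(\<Pi>\<^sub>M i\<in>{i}. lborel))"
    proof (rule nn_integral_cong)
      fix x assume "x \<in> space (\<Pi>\<^sub>M i\<in>{i}. (lborel :: real measure))"
      then have "x = e (x i)" by (auto simp: e_def space_PiM PiE_iff extensional_def)
      then show "(indicator {x \<in> box_on {i}. \<phi> x \<le> c} x :: ennreal) = indicator (S c) (x i)"
        using e[of "x i"] by (auto simp: S_def indicator_def)
    qed
    also have "\<dots> = (\<integral>\<^sup>+s. indicator (S c) s \<partial>lborel)"
      using S_meas by (intro lborel_product.product_nn_integral_singleton) auto
    also have "\<dots> = emeasure lborel (S c)" using S_meas by simp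
    finally show ?thesis by (metis enn2real_ennreal measure_def sublevel_vol_nonneg)
  qed
  have pos: "0 < simplex_vol (card {i}) t" using t simplex_vol_1[of t] by (simp del: simplex_vol.simps)
  have ne: "S c \<noteq> {}" using vol pos by (auto simp: S_vol)
  have "min 1 (measure lborel (S c) + H) \<le> measure lborel (S (c + H))"
  proof (rule interval_enlargement)
    fix s x assume s: "s \<in> S c" and x: "x \<in> {0..1}" "\<bar>x - s\<bar> \<le> H"
    have "\<phi> (e x) - \<phi> (e s) \<le> (\<Sum>j\<in>{i}. \<bar>e x j - e s j\<bar>)"
      using \<phi> s x e unfolding l1_Lipschitz_on_box_def S_def by blast
    then show "x \<in> S (c + H)" using s x by (auto simp: S_def e_def)
  qed (use S_meas ne H in \<open>auto simp: S_def\<close>)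
  then show "simplex_vol (card {i}) (t + H) \<le> sublevel_vol {i} \<phi> (c + H)"
    using vol H t simplex_vol_1[of t] simplex_vol_1[of "t + H"] by (simp add: S_vol del: simplex_vol.simps)
qed

text \<open>The induction step on the grid of mesh \<open>1 / N\<close>.  The slack \<open>1 / N\<close> occurs twice, when the volumes are
replaced by layer sums before the first step and when they are recovered after the last one; the \<open>k\<close>
steps in between are exact, so the error does not accumulate.\<close>

lemma sublevel_grid_growth:
  fixes I :: "'i set"
  assumes I: "finite I" "i \<notin> I" "I \<noteq> {}" and iso: "simplex_isoperimetric I"
    and \<phi>: "l1_Lipschitz_on_box (insert i I) \<phi>" and N: "0 < N"
    and start: "simplex_vol (Suc (card I)) (real r / real N) + 1 / real N < sublevel_vol (insert i I) \<phi> c"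
  shows "simplex_vol (Suc (card I)) (real (r + k) / real N) - 1 / real N
    \<le> sublevel_vol (insert i I) \<phi> (c + real k / real N)"
proof -
  define n where "n = card I"
  define M where "M = n * N"
  define h where "h = 1 / real N"
  have n: "0 < n" using I by (simp add: n_def card_gt_0_iff)
  have M: "1 \<le> M" using n N by (simp add: M_def)
  have h: "0 < h" using N by (simp add: h_def)
  have Mh: "real M * h = real n" using N by (simp add: M_def h_def)
  define G where "G = (\<lambda>j::nat. simplex_vol n (real j * h))"
  define a where "a = (\<lambda>j. G j - G (j - 1))"
  have G0: "G 0 = 0" using simplex_vol_0[OF n] by (simp add: G_def)
  have Gmono: "mono G" unfolding G_def using h by (intro monoI monoD[OF simplex_vol_mono]) auto
  have GM: "G j = 1" if "M \<le> j" for j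
  proof -
    have "real M * h \<le> real j * h" using that h by (intro mult_right_mono) auto
    then show ?thesis using Mh by (simp add: G_def simplex_vol_ge)
  qed
  have Gstep: "G (Suc j) - G j \<le> h" for j
    using simplex_vol_lipschitz[OF n, of "real j * h" "real (Suc j) * h"] h by (simp add: G_def algebra_simps)
  have Gless: "simplex_vol n p < G j" if "p < real j * h" "1 \<le> j" "j \<le> M" for p j
  proof -
    have "real j * h \<le> real M * h" using that h by (intro mult_right_mono) auto
    then have "simplex_vol n (max 0 p) < G j"
      unfolding G_def using that h n Mh by (intro simplex_vol_strict_mono) auto
    moreover have "simplex_vol n p \<le> simplex_vol n (max 0 p)" by (intro monoD[OF simplex_vol_mono]) auto
    ultimately show ?thesis by simp
  qed
  have a_pos: "0 < a j" if "1 \<le> j" "j \<le> M" for j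
  proof -
    have "G (j - 1) < G j"
      using Gless[of "real (j - 1) * h" j] that h by (simp add: G_def)
    then show ?thesis by (simp add: a_def)
  qed
  have aM: "a (Suc M) = 0" by (simp add: a_def GM)
  have a_lc: "a (Suc j) * a i' \<le> a (Suc i') * a j" if "1 \<le> i'" "i' \<le> j" for i' j
  proof -
    obtain p q where pq: "i' = Suc p" "j = Suc q" using \<open>1 \<le> i'\<close> \<open>i' \<le> j\<close>
      by (metis One_nat_def Suc_le_D le_trans)
    have "real p * h \<le> real q * h" using that pq h by (intro mult_right_mono) auto
    then show ?thesis
      using simplex_vol_increments_log_concave[of h "real p * h" "real q * h" h n] h
      by (simp add: a_def G_def pq algebra_simps)
  qed
  define f where "f = (\<lambda>k s. sublevel_vol I (\<lambda>x. \<phi> (x(i := s))) (c + real k * h))"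
  define V where "V = (\<lambda>k. sublevel_vol (insert i I) \<phi> (c + real k * h))"
  define A where "A = (\<lambda>k j. {s \<in> {0..1}. G j \<le> f k s})"
  define x where "x = (\<lambda>k j. measure lborel (A k j))"
  have meas: "\<phi> \<in> borel_measurable (\<Pi>\<^sub>M i\<in>insert i I. lborel)"
    using \<phi> by (simp add: l1_Lipschitz_on_box_def)
  note slice = sublevel_vol_insert[OF I(1,2) meas]
  have f01: "0 \<le> f k s" "f k s \<le> 1" for k s
    unfolding f_def by (auto intro!: sublevel_vol_nonneg emeasure_sublevel(2) I slice(3))
  have upd: "z(i := s) \<in> box_on (insert i I)" if "z \<in> box_on I" "s \<in> {0..1}" for z s
    using that I(2) by (auto simp: box_on_def PiE_iff extensional_def)
  have slice_lip: "l1_Lipschitz_on_box I (\<lambda>x. \<phi> (x(i := s)))" if s: "s \<in> {0..1}" for s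
    unfolding l1_Lipschitz_on_box_def
  proof (intro conjI ballI slice(3))
    fix y z assume "y \<in> box_on I" "z \<in> box_on I"
    then have "\<phi> (y(i := s)) - \<phi> (z(i := s)) \<le> (\<Sum>j\<in>insert i I. \<bar>(y(i := s)) j - (z(i := s)) j\<bar>)"
      using \<phi> upd s unfolding l1_Lipschitz_on_box_def by blast
    also have "\<dots> = (\<Sum>j\<in>I. \<bar>y j - z j\<bar>)" proof -
      have "j \<noteq> i" if "j \<in> I" for j using I(2) that by blast
      then show ?thesis using I(1,2) by simp
    qed
    finally show "\<phi> (y(i := s)) - \<phi> (z(i := s)) \<le> (\<Sum>j\<in>I. \<bar>y j - z j\<bar>)" .
  qed
  have f_shift: "f k s \<le> f (Suc k) s'" if s: "s \<in> {0..1}" "s' \<in> {0..1}" "\<bar>s' - s\<bar> \<le> h" for k s s'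
    unfolding f_def
  proof (rule sublevel_vol_mono[OF I(1) slice(3) slice(3)])
    fix z assume z: "z \<in> box_on I" "\<phi> (z(i := s)) \<le> c + real k * h"
    have "\<phi> (z(i := s')) - \<phi> (z(i := s)) \<le> (\<Sum>j\<in>insert i I. \<bar>(z(i := s')) j - (z(i := s)) j\<bar>)"
      using \<phi> upd s z unfolding l1_Lipschitz_on_box_def by blast
    also have "\<dots> = \<bar>s' - s\<bar> + (\<Sum>j\<in>I. 0)"
    proof -
      have "j \<noteq> i" if "j \<in> I" for j using I(2) that by blast
      then show ?thesis using I(1,2) by simp
    qed
    finally show "\<phi> (z(i := s')) \<le> c + real (Suc k) * h" using z s by (simp add: algebra_simps)
  qed
  have f_grow: "G (Suc j) \<le> f (Suc k) s" if "s \<in> {0..1}" "1 \<le> j" "G j \<le> f k s" for j k s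
  proof -
    have "simplex_vol (card I) (real j * h + h) \<le> sublevel_vol I (\<lambda>x. \<phi> (x(i := s))) (c + real k * h + h)"
      using iso slice_lip[OF that(1)] that(2,3) h unfolding simplex_isoperimetric_def
      by (auto simp: G_def f_def n_def)
    then show ?thesis by (simp add: G_def f_def n_def algebra_simps)
  qed
  have A_meas: "A k j \<in> sets lborel" for k j
  proof -
    have [measurable]: "f k \<in> borel_measurable borel" unfolding f_def by (rule slice(2))
    show ?thesis unfolding A_def by measurable
  qed
  have A_fm: "A k j \<in> fmeasurable lborel" for k j
  proof (rule fmeasurableI2[OF _ _ A_meas])
    show "{0..1::real} \<in> fmeasurable lborel" by (simp add: fmeasurable_def)
  qed (auto simp: A_def)
  have layers: "(\<Sum>j=1..M. a j * x k j) \<le> V k" "V k \<le> (\<Sum>j=1..M. a j * x k j) + h" for k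
    using layer_integral[OF G0 Gmono GM[OF order_refl] Gstep, of "f k" "V k"] f01 slice(1) slice(2)
    by (auto simp: f_def V_def x_def A_def a_def sublevel_vol_nonneg)
  have x01: "0 \<le> x k j" "x k j \<le> 1" for k j
  proof -
    have "x k j \<le> measure lborel {0..1::real}" unfolding x_def
      by (rule measure_mono_fmeasurable[OF _ A_meas]) (auto simp: A_def fmeasurable_def)
    then show "0 \<le> x k j" "x k j \<le> 1" by (simp_all add: x_def)
  qed
  have x_anti: "x k j' \<le> x k j" if "j \<le> j'" for k j j'
    unfolding x_def using monoD[OF Gmono that] by (intro measure_mono_fmeasurable A_meas A_fm) (auto simp: A_def)
  have x_shift: "x k j \<le> x (Suc k) (Suc j)" if "1 \<le> j" for k j
    unfolding x_def using f_grow[OF _ that] by (intro measure_mono_fmeasurable A_meas A_fm) (auto simp: A_def)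
  have x_grow: "min 1 (x k j + h) \<le> x (Suc k) j" if "0 < x k j" for k j
    unfolding x_def
  proof (rule interval_enlargement[OF A_meas A_meas])
    show "A k j \<noteq> {}" using that by (auto simp: x_def)
    show "s' \<in> A (Suc k) j" if "s \<in> A k j" "s' \<in> {0..1}" "\<bar>s' - s\<bar> \<le> h" for s s'
      using f_shift[of s s' k] that by (auto simp: A_def)
  qed (use h in \<open>auto simp: A_def\<close>)
  define z where "z = (\<lambda>(r::nat) (j::nat). max 0 (min 1 (h * (real r - real j))))"
  have z_layers: "(\<Sum>j=1..M. a j * z r j) \<le> simplex_vol (Suc n) (real r * h)" 
      "simplex_vol (Suc n) (real r * h) \<le> (\<Sum>j=1..M. a j * z r j) + h" for r
  proof -
    let ?f = "\<lambda>s. simplex_vol n (real r * h - s)"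
    have m[measurable]: "simplex_vol n \<in> borel_measurable borel"
      by (rule borel_measurable_mono[OF simplex_vol_mono])
    have zA: "measure lborel {s \<in> {0..1}. G j \<le> ?f s} = z r j" if "j \<in> {1..M}" for j
    proof -
      have iff: "G j \<le> ?f s \<longleftrightarrow> s \<le> h * (real r - real j)" for s
      proof
        assume "G j \<le> ?f s"
        then have "\<not> real r * h - s < real j * h" using Gless[of "real r * h - s" j] that by auto
        then show "s \<le> h * (real r - real j)" by (simp add: algebra_simps)
      next
        assume "s \<le> h * (real r - real j)"
        then show "G j \<le> ?f s" unfolding G_def by (intro monoD[OF simplex_vol_mono]) (simp add: algebra_simps)
      qed
      have "{s \<in> {0..1}. G j \<le> ?f s} = {s \<in> {0..1}. s \<le> h * (real r - real j)}" by (simp only: iff)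
      also have "\<dots> = {0..min 1 (h * (real r - real j))}" by auto
      finally show ?thesis by (simp add: z_def max_def)
    qed
    have "(\<Sum>j=1..M. (G j - G (j - 1)) * measure lborel {s \<in> {0..1}. G j \<le> ?f s}) = (\<Sum>j=1..M. a j * z r j)"
    proof (intro sum.cong refl)
      fix j assume "j \<in> {1..M}"
      from zA[OF this] show "(G j - G (j - 1)) * measure lborel {s \<in> {0..1}. G j \<le> ?f s} = a j * z r j"
        by (simp only: a_def)
    qed
    moreover have "(\<Sum>j=1..M. (G j - G (j - 1)) * measure lborel {s \<in> {0..1}. G j \<le> ?f s})
        \<le> simplex_vol (Suc n) (real r * h)"
      "simplex_vol (Suc n) (real r * h)
        \<le> (\<Sum>j=1..M. (G j - G (j - 1)) * measure lborel {s \<in> {0..1}. G j \<le> ?f s}) + h"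
      by (rule layer_integral[OF G0 Gmono GM[OF order_refl] Gstep];
          simp add: simplex_vol_nonneg simplex_vol_le_1 nn_integral_simplex_vol del: simplex_vol.simps)+
    ultimately show "(\<Sum>j=1..M. a j * z r j) \<le> simplex_vol (Suc n) (real r * h)" 
      "simplex_vol (Suc n) (real r * h) \<le> (\<Sum>j=1..M. a j * z r j) + h"
      by (simp_all only:)
  qed
  have start': "simplex_vol (Suc n) (real r * h) + h < V 0"
    using start by (simp add: n_def h_def V_def del: simplex_vol.simps)
  \<comment> \<open>Every layer length is bounded by the first one, so a positive layer sum makes it positive.\<close>
  have x1: "0 < x 0 1"
  proof (rule ccontr)
    assume "\<not> 0 < x 0 1"
    then have "x 0 j = 0" if "1 \<le> j" for j using x_anti[OF that, of 0] x01(1)[of 0 j] by linarith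
    then have "(\<Sum>j=1..M. a j * x 0 j) = 0" by (intro sum.neutral) auto
    then show False using start' layers(2)[of 0] simplex_vol_nonneg[of "Suc n" "real r * h"]
      by (simp del: simplex_vol.simps)
  qed
  have iter: "0 < x k 1 \<and> (\<Sum>j=1..M. a j * z (r + k) j) \<le> (\<Sum>j=1..M. a j * x k j)" for k
  proof (induction k)
    case 0
    then show ?case using x1 z_layers(1)[of r] start' layers(2)[of 0] by (simp del: simplex_vol.simps)
  next
    case (Suc k)
    have "(\<Sum>j=1..M. a j * z (Suc (r + k)) j) \<le> (\<Sum>j=1..M. a j * x (Suc k) j)"
      unfolding z_def
    proof (rule staircase_growth[OF _ a_pos aM a_lc x_anti x01(1)])
      show "(\<Sum>j=1..M. a j * max 0 (min 1 (h * (real (r + k) - real j)))) \<le> (\<Sum>j=1..M. a j * x k j)"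
        using Suc unfolding z_def by blast
    qed (use Suc x_shift x_grow x01 h in auto)
    moreover have "0 < x (Suc k) 1" using x_grow[of k 1] Suc h by (auto simp: min_def split: if_splits)
    ultimately show ?case by simp
  qed
  have "simplex_vol (Suc n) (real (r + k) * h) - h \<le> V k"
    using z_layers(2)[of "r + k"] iter[of k] layers(1)[of k] by linarith
  then show ?thesis by (simp add: n_def h_def V_def del: simplex_vol.simps of_nat_add)
qed

text \<open>The grid estimate in the limit of small mesh.  Starting from a slightly smaller simplex, of size
\<open>t - \<delta>\<close>, makes room for the initial slack, since \<open>simplex_vol\<close> is strictly increasing; the loss
at the end is controlled by the Lipschitz continuity of \<open>simplex_vol\<close>.\<close>

lemma simplex_isoperimetric_insert:
  assumes I: "finite I" "i \<notin> I" "I \<noteq> {}" and iso: "simplex_isoperimetric I"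
  shows "simplex_isoperimetric (insert i I)"
  unfolding simplex_isoperimetric_def
proof (intro allI impI)
  fix \<phi> :: "('a \<Rightarrow> real) \<Rightarrow> real" and c t' H :: real
  assume \<phi>: "l1_Lipschitz_on_box (insert i I) \<phi>" and t': "0 < t'" and H: "0 \<le> H"
    and vol': "simplex_vol (card (insert i I)) t' \<le> sublevel_vol (insert i I) \<phi> c"
  define n where "n = Suc (card I)"
  let ?V = "sublevel_vol (insert i I) \<phi>" and ?G = "simplex_vol n"
  have n: "card (insert i I) = n" "0 < n" using I by (auto simp: n_def)
  have meas: "\<phi> \<in> borel_measurable (\<Pi>\<^sub>M i\<in>insert i I. lborel)"
    using \<phi> by (simp add: l1_Lipschitz_on_box_def)
  have Vmono: "?V p \<le> ?V q" if "p \<le> q" for p q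
    using that I by (intro sublevel_vol_mono meas) auto
  define t where "t = min t' (real n)"
  have t: "0 < t" "t \<le> real n" using t' n by (auto simp: t_def)
  \<comment> \<open>Beyond size n the simplex is the whole cube, so t may be cut off there; strict monotonicity
      is available only up to n.\<close>
  have Gt: "?G (t' + s) = ?G (t + s)" if "0 \<le> s" for s
    using that by (auto simp: t_def min_def simplex_vol_ge)
  have vol: "?G t \<le> ?V c" using vol' Gt[of 0] by (simp add: n)
  have "?G (t + H) \<le> ?V (c + H)"
  proof (rule field_le_epsilon)
    fix e :: real assume e: "0 < e"
    define \<delta> where "\<delta> = min (t / 2) (e / 4)"
    have \<delta>: "0 < \<delta>" "\<delta> < t" "\<delta> \<le> e / 4" using t e by (auto simp: \<delta>_def min_def)
    have "?G (t - \<delta>) < ?G t" using \<delta> t n by (intro simplex_vol_strict_mono) auto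
    then obtain N :: nat where N: "1 / real (Suc N) < min \<delta> (?G t - ?G (t - \<delta>))"
      using nat_approx_posE[of "min \<delta> (?G t - ?G (t - \<delta>))"] \<delta> by auto
    define h where "h = 1 / real (Suc N)"
    have h: "0 < h" "h < \<delta>" "h < ?G t - ?G (t - \<delta>)" using N by (auto simp: h_def)
    define r where "r = nat \<lfloor>(t - \<delta>) / h\<rfloor>"
    define k where "k = nat \<lfloor>H / h\<rfloor>"
    have r: "real r * h \<le> t - \<delta>" "t - \<delta> - h \<le> real r * h"
    proof -
      have "0 \<le> (t - \<delta>) / h" using h \<delta> by simp
      then have "real r \<le> (t - \<delta>) / h" "(t - \<delta>) / h \<le> real r + 1" unfolding r_def by linarith+
      then show "real r * h \<le> t - \<delta>" "t - \<delta> - h \<le> real r * h" using h by (auto simp: field_simps)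
    qed
    have k: "real k * h \<le> H" "H - h \<le> real k * h"
    proof -
      have "0 \<le> H / h" using h H by simp
      then have "real k \<le> H / h" "H / h \<le> real k + 1" unfolding k_def by linarith+
      then show "real k * h \<le> H" "H - h \<le> real k * h" using h by (auto simp: field_simps)
    qed
    have "?G (real r * h) + h < ?V c"
      using monoD[OF simplex_vol_mono r(1), of n] h vol by simp
    then have "?G (real (r + k) * h) - h \<le> ?V (c + real k * h)"
      using sublevel_grid_growth[OF I iso \<phi>, of "Suc N" r c k]
      by (simp add: n_def h_def del: simplex_vol.simps of_nat_add of_nat_Suc)
    moreover have "?G (t + H) \<le> ?G (real (r + k) * h) + (\<delta> + 2 * h)"
    proof -
      have le: "t + H - (\<delta> + 2 * h) \<le> real (r + k) * h" using r k by (simp add: algebra_simps)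
      have "?G (t + H) \<le> ?G (t + H - (\<delta> + 2 * h)) + (\<delta> + 2 * h)"
        using simplex_vol_lipschitz[OF n(2), of "t + H - (\<delta> + 2 * h)" "t + H"] h \<delta> by simp
      then show ?thesis using monoD[OF simplex_vol_mono le, of n] by simp
    qed
    moreover have "?V (c + real k * h) \<le> ?V (c + H)" using k by (intro Vmono) auto
    ultimately show "?G (t + H) \<le> ?V (c + H) + e" using h \<delta> by linarith
  qed
  then show "simplex_vol (card (insert i I)) (t' + H) \<le> sublevel_vol (insert i I) \<phi> (c + H)"
    using Gt[OF H] by (simp add: n)
qed

theorem simplex_isoperimetric_box:
  assumes "finite I" "I \<noteq> {}" shows "simplex_isoperimetric I"
  using assms by (induction rule: finite_ne_induct)
    (auto intro: simplex_isoperimetric_singleton simplex_isoperimetric_insert)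

section \<open>From volume growth to the iso-Lipschitz order\<close>

lemma msupport_simplex_law:
  assumes "real_distribution \<gamma>" and cdf: "cdf \<gamma> = simplex_vol n" and n: "0 < n"
  shows "msupport \<gamma> = {0..real n}"
proof -
  interpret real_distribution \<gamma> by fact
  have Ioc: "measure \<gamma> {p<..q} = simplex_vol n q - simplex_vol n p" if "p < q" for p q
    using cdf_diff_eq[OF that] by (simp add: cdf)
  show ?thesis
  proof (intro equalityI subsetI)
    fix x assume x: "x \<in> msupport \<gamma>"
    have "\<not> x < 0"
    proof
      assume "x < 0"
      then have "0 < emeasure \<gamma> {..<0}" using x by (auto simp: msupport_def)
      also have "\<dots> \<le> emeasure \<gamma> {..0}" by (intro emeasure_mono) auto
      also have "\<dots> = ennreal (cdf \<gamma> 0)" by (simp add: cdf_def emeasure_eq_measure)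
      finally show False using n by (simp add: cdf simplex_vol_0)
    qed
    moreover have "\<not> real n < x"
    proof
      assume "real n < x"
      then have "0 < emeasure \<gamma> {real n<..}" using x by (auto simp: msupport_def)
      moreover have "measure \<gamma> {real n<..} = 1 - cdf \<gamma> (real n)"
        using prob_compl[of "{..real n}"] by (simp add: cdf_def Compl_eq_Diff_UNIV[symmetric] Compl_atMost)
      ultimately show False by (simp add: cdf simplex_vol_ge emeasure_eq_measure)
    qed
    ultimately show "x \<in> {0..real n}" by simp
  next
    fix x assume x: "x \<in> {0..real n}"
    show "x \<in> msupport \<gamma>" unfolding msupport_def
    proof (intro CollectI allI impI)
      fix U :: "real set" assume U: "open U" "x \<in> U"
      then obtain e where e: "0 < e" "ball x e \<subseteq> U" by (meson open_contains_ball)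
      define p where "p = max 0 (x - e / 2)"
      define q where "q = min (real n) (x + e / 2)"
      have pq: "0 \<le> p" "p < q" "q \<le> real n" using x e n by (auto simp: p_def q_def)
      have "0 < measure \<gamma> {p<..q}" using Ioc[OF pq(2)] simplex_vol_strict_mono[OF n pq] by simp
      moreover have "{p<..q} \<subseteq> U" using e by (auto simp: p_def q_def dist_real_def intro!: subsetD[OF e(2)])
      then have "emeasure \<gamma> {p<..q} \<le> emeasure \<gamma> U" using U by (intro emeasure_mono) auto
      ultimately show "0 < emeasure \<gamma> U" by (simp add: emeasure_eq_measure)
    qed
  qed
qed

text \<open>The witness is the quantile function \<open>f t = Inf (S t)\<close>.  The growth assumption says that \<open>s \<in> S t\<close> implies
\<open>s + (u - t) \<in> S u\<close>, which is the Lipschitz bound.  Requiring \<open>0 < cdf \<mu> s\<close> in \<open>S t\<close> matters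
only for \<open>t = 0\<close>: it makes \<open>f 0\<close> the left end of the support of \<open>\<mu>\<close> instead of an infimum over all reals.\<close>

lemma iso_Lipschitz_ge_simplex_law:
  assumes "real_distribution \<gamma>" and cdf: "cdf \<gamma> = simplex_vol n" and n: "0 < n"
    and "real_distribution \<mu>"
    and grow: "\<And>c t H. 0 < t \<Longrightarrow> 0 \<le> H \<Longrightarrow> simplex_vol n t \<le> cdf \<mu> c \<Longrightarrow> simplex_vol n (t + H) \<le> cdf \<mu> (c + H)"
  shows "\<gamma> \<succ>' \<mu>"
proof -
  interpret \<gamma>: real_distribution \<gamma> by fact
  interpret \<mu>: real_distribution \<mu> by fact
  let ?G = "simplex_vol n" and ?F = "cdf \<mu>"
  have Fmono: "?F p \<le> ?F q" if "p \<le> q" for p q using that by (rule \<mu>.cdf_nondecreasing)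
  have G0: "?G 0 = 0" using n by (simp add: simplex_vol_0)
  have Ioc: "measure \<gamma> {p<..q} = ?G q - ?G p" if "p \<le> q" for p q
    using \<gamma>.cdf_diff_eq[of p q] that by (cases "p = q") (auto simp: cdf)
  have supp: "msupport \<gamma> = {0..real n}" by (rule msupport_simplex_law) fact+
  define S where "S = (\<lambda>t. {s. 0 < ?F s \<and> ?G t \<le> ?F s})"
  define f where "f = (\<lambda>t. Inf (S t))"
  have up: "s' \<in> S t" if "s \<in> S t" "s \<le> s'" for s s' t
    using that Fmono[OF that(2)] by (auto simp: S_def)
  have shift: "s + (u - t) \<in> S u" if s: "s \<in> S t" and tu: "0 \<le> t" "t \<le> u" for s t u
  proof -
    \<comment> \<open>The growth assumption applies only to positive sizes; for t = 0 use that F s > 0 is at least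
        the volume of a small simplex.\<close>
    obtain \<tau> where \<tau>: "t \<le> \<tau>" "0 < \<tau>" "?G \<tau> \<le> ?F s"
    proof (cases "t = 0")
      case True
      have "0 < ?F s" using s by (simp add: S_def)
      then show ?thesis using that[of "?F s"] simplex_vol_lipschitz[OF n, of 0 "?F s"] G0 True by simp
    next
      case False
      then show ?thesis using that[of t] s tu by (simp add: S_def)
    qed
    have "?G u \<le> ?G (\<tau> + (u - t))" using \<tau> by (intro monoD[OF simplex_vol_mono]) simp
    also have "\<dots> \<le> ?F (s + (u - t))" using \<tau> tu by (intro grow) auto
    finally show ?thesis using s tu Fmono[of s "s + (u - t)"] by (auto simp: S_def)
  qed
  have S_ne: "S t \<noteq> {}" if "0 \<le> t" "t \<le> real n" for t
  proof -
    have "eventually (\<lambda>s. 0 < ?F s) at_top"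
      using order_tendstoD(1)[OF \<mu>.cdf_lim_at_top_prob, of 0] by simp
    then obtain s where "0 < ?F s" by (meson eventually_happens trivial_limit_at_top_linorder)
    then have "s \<in> S 0" by (simp add: S_def G0)
    from shift[OF this order_refl that(1)] show ?thesis by blast
  qed
  obtain l where l: "\<And>s t. s \<in> S t \<Longrightarrow> l \<le> s"
  proof -
    have "eventually (\<lambda>s. ?F s < 1) at_bot"
      using order_tendstoD(2)[OF \<mu>.cdf_lim_at_bot, of 1] by simp
    then obtain s0 where s0: "?F s0 < 1" by (meson eventually_happens trivial_limit_at_bot_linorder)
    show thesis
    proof (rule that[of "s0 - real n"])
      fix s t assume "s \<in> S t"
      then have "s \<in> S 0" by (auto simp: S_def G0)
      from shift[OF this, of "real n"] have "1 \<le> ?F (s + real n)" by (simp add: S_def simplex_vol_ge)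
      then have "\<not> s + real n \<le> s0" using Fmono[of "s + real n" s0] s0 by auto
      then show "s0 - real n \<le> s" by simp
    qed
  qed
  have bdd: "bdd_below (S t)" for t using l by (rule bdd_belowI)
  have f_mono: "f t \<le> f u" if "0 \<le> t" "t \<le> u" "u \<le> real n" for t u
    unfolding f_def
  proof (rule cInf_superset_mono[OF S_ne bdd])
    show "S u \<subseteq> S t" using monoD[OF simplex_vol_mono that(2), of n] by (auto simp: S_def)
  qed (use that in auto)
  have f_lip: "f u \<le> f t + (u - t)" if "0 \<le> t" "t \<le> u" "u \<le> real n" for t u
  proof -
    have "f u - (u - t) \<le> Inf (S t)"
    proof (rule cInf_greatest)
      fix s assume "s \<in> S t"
      then have "f u \<le> s + (u - t)" unfolding f_def by (intro cInf_lower bdd shift that)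
      then show "f u - (u - t) \<le> s" by simp
    qed (use S_ne that in auto)
    then show ?thesis by (simp add: f_def)
  qed
  have above: "s \<in> S t" if "f t < s" "0 \<le> t" "t \<le> real n" for s t
    using cInf_lessD[OF S_ne, of t s] that up unfolding f_def by force
  have f_le_iff: "f t \<le> x \<longleftrightarrow> x \<in> S t" if "0 < t" "t \<le> real n" for t x
  proof
    assume "x \<in> S t"
    then show "f t \<le> x" unfolding f_def by (intro cInf_lower bdd)
  next
    assume "f t \<le> x"
    have "?G t \<le> ?F (f t)"
    proof (rule tendsto_lowerbound)
      show "(?F \<longlongrightarrow> ?F (f t)) (at_right (f t))"
        using \<mu>.cdf_is_right_cont[of "f t"] by (simp add: continuous_within)
      show "eventually (\<lambda>s. ?G t \<le> ?F s) (at_right (f t))"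
        unfolding eventually_at_filter using above that by (auto simp: S_def intro!: always_eventually)
    qed simp
    moreover have "0 < ?G t" using simplex_vol_strict_mono[OF n, of 0 t] that G0 by simp
    ultimately have "f t \<in> S t" by (simp add: S_def)
    then show "x \<in> S t" using up \<open>f t \<le> x\<close> by blast
  qed
  have lip: "1-lipschitz_on {0..real n} f"
  proof (rule lipschitz_onI)
    fix t u assume "t \<in> {0..real n}" "u \<in> {0..real n}"
    then show "dist (f t) (f u) \<le> 1 * dist t u"
      using f_mono[of t u] f_lip[of t u] f_mono[of u t] f_lip[of u t]
      by (cases "t \<le> u") (auto simp: dist_real_def)
  qed simp
  then have cont: "continuous_on {0..real n} f" by (rule lipschitz_on_continuous_on)
  have into: "f t \<in> msupport \<mu>" if t: "0 \<le> t" "t \<le> real n" for t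
    unfolding msupport_def
  proof (intro CollectI allI impI)
    fix U :: "real set" assume U: "open U" "f t \<in> U"
    then obtain e where e: "0 < e" "ball (f t) e \<subseteq> U" by (meson open_contains_ball)
    have "f t + e / 2 \<in> S t" using above[of t "f t + e/2"] e t by simp
    moreover have "f t - e / 2 \<notin> S t" 
      using cInf_lower[OF _ bdd, of "f t - e/2" t] e unfolding f_def by auto
    ultimately have "?F (f t - e / 2) < ?F (f t + e / 2)"
      by (auto simp: S_def not_less not_le intro: le_less_trans less_le_trans)
    then have "0 < measure \<mu> {f t - e / 2<..f t + e / 2}"
      using \<mu>.cdf_diff_eq[of "f t - e / 2" "f t + e / 2"] e by simp
    moreover have "{f t - e / 2<..f t + e / 2} \<subseteq> U"
      using e(1) by (auto simp: dist_real_def intro!: subsetD[OF e(2)])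
    then have "emeasure \<mu> {f t - e / 2<..f t + e / 2} \<le> emeasure \<mu> U" using U by (intro emeasure_mono) auto
    ultimately show "0 < emeasure \<mu> U" by (simp add: \<mu>.emeasure_eq_measure)
  qed
  let ?R = "restrict_space \<gamma> {0..real n}"
  have "measure \<gamma> {0<..real n} = 1" using Ioc[of 0 "real n"] by (simp add: G0 simplex_vol_ge)
  then have "measure \<gamma> {0..real n} = 1"
    using \<gamma>.finite_measure_mono[of "{0<..real n}" "{0..real n}"] \<gamma>.prob_le_1[of "{0..real n}"] by force
  then have R: "prob_space ?R"
    by (intro prob_space_restrict_space) (auto simp: \<gamma>.emeasure_eq_measure)
  have sets_R: "sets ?R = sets (restrict_space borel {0..real n})"
    by (intro sets_restrict_space_cong) simp
  have f_meas: "f \<in> borel_measurable ?R"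
    using borel_measurable_continuous_on_restrict[OF cont] measurable_cong_sets[OF sets_R refl] by blast
  have "distr ?R borel f = \<mu>"
  proof (rule cdf_unique)
    show "real_distribution (distr ?R borel f)"
      using R f_meas by (intro prob_space.real_distribution_distr) auto
    show "cdf (distr ?R borel f) = ?F"
    proof
      fix x
      let ?T = "{0..real n} \<inter> f -` {..x}"
      have "closed ?T" using cont by (intro continuous_closed_preimage) auto
      then have T: "?T \<in> sets \<gamma>" by simp
      have "cdf (distr ?R borel f) x = measure ?R ?T"
        unfolding cdf_def using f_meas
        by (subst measure_distr) (auto simp: space_restrict_space intro!: arg_cong[where f = "measure _"])
      also have "\<dots> = measure \<gamma> ?T" by (intro measure_restrict_space) auto
      also have "\<dots> = ?F x"
      proof -
        have "\<exists>\<tau>\<ge>0. \<tau> \<le> real n \<and> ?G \<tau> = ?F x"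
          using continuous_simplex_vol[OF n] \<mu>.cdf_nonneg[of x] \<mu>.cdf_bounded_prob[of x]
          by (intro IVT') (auto simp: G0 simplex_vol_ge)
        then obtain \<tau> where \<tau>: "0 \<le> \<tau>" "\<tau> \<le> real n" "?G \<tau> = ?F x" by blast
        have iff: "f t \<le> x \<longleftrightarrow> t \<le> \<tau>" if t: "0 < t" "t \<le> real n" for t
        proof -
          have pos: "0 < ?G t" using simplex_vol_strict_mono[OF n, of 0 t] t G0 by simp
          have "f t \<le> x \<longleftrightarrow> ?G t \<le> ?G \<tau>" using f_le_iff[OF t, of x] pos by (auto simp: S_def \<tau>(3))
          also have "\<dots> \<longleftrightarrow> t \<le> \<tau>"
            using simplex_vol_strict_mono[OF n, of \<tau> t] monoD[OF simplex_vol_mono, of t \<tau> n] \<tau> t by force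
          finally show ?thesis .
        qed
        \<comment> \<open>The preimage is a half-open or closed interval from 0 to the point where G takes the value F x;
            both have the same measure.\<close>
        have "{0<..\<tau>} \<subseteq> ?T" using iff \<tau> by auto
        then have "?F x \<le> measure \<gamma> ?T"
          using \<gamma>.finite_measure_mono[OF _ T, of "{0<..\<tau>}"] Ioc[OF \<tau>(1)] \<tau> G0 by simp
        moreover have "?T \<subseteq> {..\<tau>}"
        proof
          fix t assume "t \<in> ?T"
          then show "t \<in> {..\<tau>}" using iff[of t] \<tau> by (cases "t = 0") auto
        qed
        then have "measure \<gamma> ?T \<le> cdf \<gamma> \<tau>" unfolding cdf_def by (intro \<gamma>.finite_measure_mono) auto
        ultimately show ?thesis using \<tau> by (simp add: cdf)
      qed
      finally show "cdf (distr ?R borel f) x = ?F x" .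
    qed
  qed fact
  then show ?thesis unfolding iso_Lipschitz_ge_def supp
    using into lip f_mono by (intro exI[of _ f]) (auto simp: mono_on_def)
qed

section \<open>The cube in Euclidean space\<close>

lemma Basis_cart: "(Basis :: (real ^ 'n) set) = range (\<lambda>i. axis i 1)"
  by (auto simp: Basis_vec_def)

lemma l1_dist_Basis: "l1_dist x y = (\<Sum>b\<in>Basis. \<bar>x \<bullet> b - y \<bullet> b\<bar>)" for x y :: "real ^ 'n"
  unfolding l1_dist_def Basis_cart
  by (subst sum.reindex) (auto simp: inj_on_def axis_eq_axis inner_axis)

lemma unit_cube_Basis: "x \<in> unit_cube \<longleftrightarrow> (\<forall>b\<in>Basis. x \<bullet> b \<in> {0..1})" for x :: "real ^ 'n"
  by (auto simp: unit_cube_def Basis_cart inner_axis)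

text \<open>The map under which Lebesgue measure on \<open>real ^ 'n\<close> is the image of the product measure indexed by the
standard basis.\<close>

definition of_coords :: "((real ^ 'n) \<Rightarrow> real) \<Rightarrow> real ^ 'n" where
  "of_coords g = (\<Sum>b\<in>Basis. g b *\<^sub>R b)"

lemma of_coords_inner: "b \<in> Basis \<Longrightarrow> of_coords g \<bullet> b = g b"
  by (simp add: of_coords_def)

lemma of_coords_measurable: "of_coords \<in> borel_measurable (\<Pi>\<^sub>M b\<in>Basis. (lborel :: real measure))"
proof -
  have "(\<lambda>g. g b) \<in> borel_measurable (\<Pi>\<^sub>M b\<in>Basis. (lborel :: real measure))" if "b \<in> Basis" for b :: "real ^ 'n"
    using measurable_component_singleton[OF that, of "\<lambda>_. lborel"] by simp
  then show ?thesis unfolding of_coords_def by (intro borel_measurable_sum borel_measurable_scaleR) auto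
qed

lemma cube_measure_sublevel:
  fixes \<phi> :: "real ^ 'n \<Rightarrow> real"
  assumes \<phi>: "\<phi> \<in> borel_measurable borel"
  shows "measure cube_measure {x \<in> unit_cube. \<phi> x \<le> c} = sublevel_vol Basis (\<lambda>g. \<phi> (of_coords g)) c"
proof -
  let ?P = "\<Pi>\<^sub>M b\<in>(Basis :: (real ^ 'n) set). (lborel :: real measure)"
  have cube: "(unit_cube :: (real ^ 'n) set) \<in> sets lborel" by (simp add: unit_cube_eq_cbox)
  have "{x \<in> space borel. \<phi> x \<le> c} \<in> sets borel"
    by (intro borel_measurable_le \<phi> borel_measurable_const)
  then have "unit_cube \<inter> {x \<in> space borel. \<phi> x \<le> c} \<in> sets borel" using cube by simp
  moreover have "unit_cube \<inter> {x \<in> space borel. \<phi> x \<le> c} = {x \<in> unit_cube. \<phi> x \<le> c}" by auto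
  ultimately have A: "{x \<in> unit_cube. \<phi> x \<le> c} \<in> sets borel" by simp
  have "measure cube_measure {x \<in> unit_cube. \<phi> x \<le> c} = measure lborel {x \<in> unit_cube. \<phi> x \<le> c}"
    unfolding cube_measure_def using cube by (intro measure_restrict_space) auto
  also have "\<dots> = measure (distr ?P borel of_coords) {x \<in> unit_cube. \<phi> x \<le> c}"
    unfolding lborel_eq[where 'a = "real ^ 'n"] of_coords_def ..
  also have "\<dots> = measure ?P (of_coords -` {x \<in> unit_cube. \<phi> x \<le> c} \<inter> space ?P)"
    using of_coords_measurable A by (intro measure_distr) auto
  also have "of_coords -` {x \<in> unit_cube. \<phi> x \<le> c} \<inter> space ?P = {g \<in> box_on Basis. \<phi> (of_coords g) \<le> c}"
    by (auto simp: unit_cube_Basis of_coords_inner box_on_def space_PiM PiE_iff extensional_def)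
  finally show ?thesis unfolding sublevel_vol_def .
qed

lemma l1_Lipschitz_on_box_of_coords:
  fixes \<phi> :: "real ^ 'n \<Rightarrow> real"
  assumes "\<phi> \<in> borel_measurable borel" "\<And>x y. \<phi> x - \<phi> y \<le> l1_dist x y"
  shows "l1_Lipschitz_on_box Basis (\<lambda>g. \<phi> (of_coords g))"
  unfolding l1_Lipschitz_on_box_def
proof (intro conjI ballI)
  show "(\<lambda>g. \<phi> (of_coords g)) \<in> borel_measurable (\<Pi>\<^sub>M b\<in>Basis. lborel)"
    using of_coords_measurable assms(1) by (rule measurable_compose)
  show "\<phi> (of_coords x) - \<phi> (of_coords y) \<le> (\<Sum>b\<in>Basis. \<bar>x b - y b\<bar>)" for x y
    using assms(2)[of "of_coords x" "of_coords y"] by (simp add: l1_dist_Basis of_coords_inner)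
qed

lemma l1_Lipschitz_continuous:
  fixes \<phi> :: "real ^ 'n \<Rightarrow> real"
  assumes "\<And>x y. \<bar>\<phi> x - \<phi> y\<bar> \<le> l1_dist x y"
  shows "continuous_on UNIV \<phi>"
proof (rule lipschitz_on_continuous_on[of "CARD('n)"], rule lipschitz_onI)
  show "dist (\<phi> x) (\<phi> y) \<le> CARD('n) * dist x y" for x y
    using assms[of x y] l1_dist_le_norm[of x y] by (simp add: dist_real_def)
qed simp

lemma prob_space_cube_measure: "prob_space cube_measure"
  by (rule prob_spaceI) (rule emeasure_cube_measure)

text \<open>Bridge to the product-space setting: distribution functions on the cube are the sublevel volumes for which
the isoperimetric inequality was proved.\<close>

lemma cdf_distr_cube:
  fixes \<phi> :: "real ^ 'n \<Rightarrow> real"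
  assumes "\<phi> \<in> borel_measurable borel"
  shows "real_distribution (distr cube_measure borel \<phi>)"
    and "cdf (distr cube_measure borel \<phi>) c = sublevel_vol Basis (\<lambda>g. \<phi> (of_coords g)) c"
proof -
  have m: "\<phi> \<in> borel_measurable cube_measure"
    using assms unfolding cube_measure_def by (intro measurable_restrict_space1) simp
  show "real_distribution (distr cube_measure borel \<phi>)"
    using prob_space_cube_measure m by (rule prob_space.real_distribution_distr)
  have "cdf (distr cube_measure borel \<phi>) c = measure cube_measure (\<phi> -` {..c} \<inter> space cube_measure)"
    unfolding cdf_def using m by (intro measure_distr) auto
  also have "\<phi> -` {..c} \<inter> space cube_measure = {x \<in> unit_cube. \<phi> x \<le> c}"
    by (auto simp: space_cube_measure)
  finally show "cdf (distr cube_measure borel \<phi>) c = sublevel_vol Basis (\<lambda>g. \<phi> (of_coords g)) c"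
    using cube_measure_sublevel[OF assms] by simp
qed

lemma l1_dist_diff_le: "\<bar>l1_dist x z - l1_dist y z\<bar> \<le> l1_dist x y" for x y z :: "real ^ 'n"
proof -
  interpret Metric_space unit_cube "l1_dist :: real ^ 'n \<Rightarrow> real ^ 'n \<Rightarrow> real" by (rule Metric_space_l1)
  have "l1_dist x z \<le> l1_dist x y + l1_dist y z" for x y z :: "real ^ 'n"
    unfolding l1_dist_def sum.distrib[symmetric] by (intro sum_mono) simp
  from this[of x z y] this[of y z x] show ?thesis using commute[of x y] by simp
qed

text \<open>The nearest-point retraction onto the cube.  Composing with it extends a function that is 1-Lipschitz on
the cube to the whole space with the same constant; the extension is continuous, hence Borel.\<close>

definition clamp_cube :: "real ^ 'n \<Rightarrow> real ^ 'n" where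
  "clamp_cube x = (\<chi> i. max 0 (min 1 (x $ i)))"

lemma clamp_cube_in: "clamp_cube x \<in> unit_cube"
  by (simp add: clamp_cube_def unit_cube_def)

lemma clamp_cube_id: "x \<in> unit_cube \<Longrightarrow> clamp_cube x = x"
  by (simp add: clamp_cube_def unit_cube_def vec_eq_iff)

lemma clamp_cube_l1: "l1_dist (clamp_cube x) (clamp_cube y) \<le> l1_dist x y"
  unfolding l1_dist_def clamp_cube_def by (intro sum_mono) (simp add: max_def min_def abs_if)

theorem theorem1p10:
  fixes d\<^sub>0 :: "real ^ 'n \<Rightarrow> real"
  assumes "\<And>x. d\<^sub>0 x = l1_dist x 0"
  shows "distr cube_measure borel d\<^sub>0 \<in> one_measurement (l1_cube :: (real ^ 'n) metric) cube_measure
    \<and> (\<forall>\<mu> \<in> one_measurement (l1_cube :: (real ^ 'n) metric) cube_measure.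
          distr cube_measure borel d\<^sub>0 \<succ>' \<mu>)"
proof
  have d0: "\<bar>d\<^sub>0 x - d\<^sub>0 y\<bar> \<le> l1_dist x y" for x y
    using l1_dist_diff_le[of x 0 y] by (simp add: assms)
  then show "distr cube_measure borel d\<^sub>0 \<in> one_measurement (l1_cube :: (real ^ 'n) metric) cube_measure"
    unfolding one_measurement_def by (auto intro!: exI[of _ d\<^sub>0])
  let ?n = "CARD('n)"
  have card: "card (Basis :: (real ^ 'n) set) = ?n" by simp
  have meas: "\<phi> \<in> borel_measurable borel" if "\<And>x y. \<bar>\<phi> x - \<phi> y\<bar> \<le> l1_dist x y" for \<phi> :: "real ^ 'n \<Rightarrow> real"
    using l1_Lipschitz_continuous[OF that] by (rule borel_measurable_continuous_onI)
  have cdf_d0: "cdf (distr cube_measure borel d\<^sub>0) = simplex_vol ?n"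
  proof
    fix t
    have "cdf (distr cube_measure borel d\<^sub>0) t = sublevel_vol Basis (\<lambda>g. d\<^sub>0 (of_coords g)) t"
      using cdf_distr_cube(2)[OF meas[OF d0]] .
    also have "\<dots> = sublevel_vol (Basis :: (real ^ 'n) set) (\<lambda>g. \<Sum>b\<in>Basis. g b) t"
    proof -
      have "d\<^sub>0 (of_coords g) = (\<Sum>b\<in>Basis. g b)" if "g \<in> box_on Basis" for g
        using that by (auto simp: assms l1_dist_Basis of_coords_inner box_on_def PiE_iff intro!: sum.cong)
      then show ?thesis unfolding sublevel_vol_def by (intro arg_cong[where f = "measure _"]) auto
    qed
    also have "\<dots> = simplex_vol ?n t" by (simp only: simplex_vol_eq_sublevel_vol[OF finite_Basis] card)
    finally show "cdf (distr cube_measure borel d\<^sub>0) t = simplex_vol ?n t" .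
  qed
  show "\<forall>\<mu> \<in> one_measurement (l1_cube :: (real ^ 'n) metric) cube_measure. distr cube_measure borel d\<^sub>0 \<succ>' \<mu>"
  proof
    fix \<mu> assume "\<mu> \<in> one_measurement (l1_cube :: (real ^ 'n) metric) cube_measure"
    then obtain \<phi> :: "real ^ 'n \<Rightarrow> real" where \<mu>: "\<mu> = distr cube_measure borel \<phi>"
      and "\<forall>x\<in>unit_cube. \<forall>y\<in>unit_cube. \<bar>\<phi> x - \<phi> y\<bar> \<le> l1_dist x y"
      unfolding one_measurement_def by auto
    then have \<phi>: "\<bar>\<phi> x - \<phi> y\<bar> \<le> l1_dist x y" if "x \<in> unit_cube" "y \<in> unit_cube" for x y
      using that by blast
    define \<psi> where "\<psi> = (\<lambda>x. \<phi> (clamp_cube x))"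
    have \<psi>: "\<bar>\<psi> x - \<psi> y\<bar> \<le> l1_dist x y" for x y
      unfolding \<psi>_def using \<phi>[OF clamp_cube_in clamp_cube_in] clamp_cube_l1 by (rule order_trans)
    have \<mu>': "\<mu> = distr cube_measure borel \<psi>"
      unfolding \<mu> \<psi>_def by (intro distr_cong) (auto simp: space_cube_measure clamp_cube_id)
    have lip: "l1_Lipschitz_on_box Basis (\<lambda>g. \<psi> (of_coords g))"
      using \<psi> by (intro l1_Lipschitz_on_box_of_coords meas) (auto simp: abs_le_iff)
    show "distr cube_measure borel d\<^sub>0 \<succ>' \<mu>"
    proof (rule iso_Lipschitz_ge_simplex_law[OF cdf_distr_cube(1)[OF meas[OF d0]] cdf_d0])
      show "real_distribution \<mu>" unfolding \<mu>' by (rule cdf_distr_cube(1)[OF meas[OF \<psi>]])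
      have F: "cdf \<mu> c = sublevel_vol Basis (\<lambda>g. \<psi> (of_coords g)) c" for c
        unfolding \<mu>' by (rule cdf_distr_cube(2)[OF meas[OF \<psi>]])
      have "simplex_isoperimetric (Basis :: (real ^ 'n) set)"
        by (rule simplex_isoperimetric_box) auto
      then show "simplex_vol ?n (t + H) \<le> cdf \<mu> (c + H)"
        if "0 < t" "0 \<le> H" "simplex_vol ?n t \<le> cdf \<mu> c" for c t H
        using that lip unfolding simplex_isoperimetric_def card F by metis
    qed simp
  qed
qed

end
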